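(* Let $\Gamma$ be a finite connected cubic graph and let $G\leq \mathrm{Aut}(\Gamma)$ act transitively on the vertices of $\Gamma$. If $G$ has an abelian normal subgroup that is not semiregular (in its action on the vertices of $\Gamma$), then $\Gamma$ is isomorphic to one of $\mathbf{K}_4$, $\mathbf{K}_{3,3}$, $\mathbf{Q}_3$, or $\mathrm{S}(\mathrm{PX}(2,r,s))$ for some integers $r\geq 3$ and $1\leq s\leq r-1$.
   Context: All graphs and groups are finite; graphs are simple and undirected. A graph is cubic if every vertex has valency 3. A permutation group on a set is semiregular if the stabiliser of every point is trivial. $\mathbf{K}_4$ is the complete graph on 4 vertices, $\mathbf{K}_{3,3}$ is the complete bipartite graph with parts of size 3, and $\mathbf{Q}_3$ is the 3-cube. For integers $r\geq 3$ and $1\leq s\leq r-1$, the graph $\mathrm{S}(\mathrm{PX}(2,r,s))$ is the cubic graph with vertex-set $\mathbb{Z}_2^s\times\mathbb{Z}_r\times\{+,-\}$ and edge-set $$\{\{(n_0,\ldots,n_{s-1},x,+),(n_1,\ldots,n_{s},x+1,-)\}\mid n_0,\ldots,n_s\in \mathbb{Z}_2,\ x\in\mathbb{Z}_r\}$$ $$\cup\ \{\{(n_0,\ldots,n_{s-1},x,+),(n_0,\ldots,n_{s-1},x,-)\}\mid n_0,\ldots,n_{s-1}\in \mathbb{Z}_2,\ x\in\mathbb{Z}_r\}.$$ *)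

theory Defs
  imports
    "HOL-Library.Z2"
    "HOL-Algebra.Group_Action"
    "Graph_Theory.Graph_Theory"
begin

text \<open>
  Finite simple undirected graphs are symmetric irreflexive arc sets on a finite vertex set
  (\<^locale>\<open>pair_graph\<close>): an edge \<open>{u, v}\<close> is the pair of arcs \<open>(u, v)\<close>, \<open>(v, u)\<close>.
\<close>

definition graph_of_edges :: "'a set \<Rightarrow> 'a set set \<Rightarrow> 'a pair_pre_digraph" where
  "graph_of_edges V E = \<lparr>pverts = V, parcs = {(u, v). u \<in> V \<and> v \<in> V \<and> {u, v} \<in> E}\<rparr>"

text \<open>In a symmetric digraph the out-degree of a vertex is its valency.\<close>

definition cubic :: "'a pair_pre_digraph \<Rightarrow> bool" where
  "cubic \<Gamma> \<longleftrightarrow> (\<forall>v \<in> pverts \<Gamma>. out_degree (with_proj \<Gamma>) v = 3)"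

definition graph_iso :: "'a pair_pre_digraph \<Rightarrow> 'b pair_pre_digraph \<Rightarrow> bool" where
  "graph_iso \<Gamma> \<Delta> \<longleftrightarrow> digraph_iso (with_proj \<Gamma>) (with_proj \<Delta>)"

definition graph_aut :: "'a pair_pre_digraph \<Rightarrow> ('a \<Rightarrow> 'a) set" where
  "graph_aut \<Gamma> = {f \<in> Bij (pverts \<Gamma>).
     \<forall>u \<in> pverts \<Gamma>. \<forall>v \<in> pverts \<Gamma>. (f u, f v) \<in> parcs \<Gamma> \<longleftrightarrow> (u, v) \<in> parcs \<Gamma>}"

definition graph_Aut :: "'a pair_pre_digraph \<Rightarrow> ('a \<Rightarrow> 'a) monoid" where
  "graph_Aut \<Gamma> = BijGroup (pverts \<Gamma>) \<lparr>carrier := graph_aut \<Gamma>\<rparr>"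

definition semiregular_action :: "('g, 'm) monoid_scheme \<Rightarrow> 'a set \<Rightarrow> ('g \<Rightarrow> 'a \<Rightarrow> 'a) \<Rightarrow> bool" where
  "semiregular_action G X \<phi> \<longleftrightarrow> (\<forall>x \<in> X. stabilizer G \<phi> x = {\<one>\<^bsub>G\<^esub>})"

definition cube_graph :: "nat \<Rightarrow> bit list pair_pre_digraph" where
  "cube_graph d = graph_of_edges {u. length u = d}
     {{u, v} | u v. length u = d \<and> length v = d \<and> card {i. i < d \<and> u ! i \<noteq> v ! i} = 1}"

text \<open>
  The vertex \<open>(n\<^sub>0, \<dots>, n\<^bsub>s-1\<^esub>, x, \<plusminus>)\<close> of \<open>S(PX(2,r,s))\<close> is \<open>([n\<^sub>0, \<dots>, n\<^bsub>s-1\<^esub>], x, \<plusminus>)\<close>, with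
  \<open>\<int>\<^sub>r\<close> represented by \<open>{0..<r}\<close>. In the first family of edges \<open>n\<close> is the whole sequence
  \<open>[n\<^sub>0, \<dots>, n\<^sub>s]\<close>, of length \<open>s + 1\<close>.
\<close>

datatype sign = Plus | Minus

definition SPX_verts :: "nat \<Rightarrow> nat \<Rightarrow> (bit list \<times> nat \<times> sign) set" where
  "SPX_verts r s = {n. length n = s} \<times> {0..<r} \<times> UNIV"

definition SPX_edges :: "nat \<Rightarrow> nat \<Rightarrow> (bit list \<times> nat \<times> sign) set set" where
  "SPX_edges r s =
     {{(butlast n, x, Plus), (tl n, (x + 1) mod r, Minus)} | n x. length n = s + 1 \<and> x < r} \<union>
     {{(n, x, Plus), (n, x, Minus)} | n x. length n = s \<and> x < r}"

definition SPX :: "nat \<Rightarrow> nat \<Rightarrow> (bit list \<times> nat \<times> sign) pair_pre_digraph" where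
  "SPX r s = graph_of_edges (SPX_verts r s) (SPX_edges r s)"

end

theory Submission
  imports Defs "HOL-Combinatorics.Permutations"
begin

text \<open>
  Let \<open>N\<close> be the abelian normal subgroup and \<open>N\<^sub>v\<close> the stabiliser of a vertex \<open>v\<close>. Because
  \<open>N\<close> is abelian, \<open>N\<^sub>v\<close> fixes the whole \<open>N\<close>-orbit of \<open>v\<close>; because \<open>N\<close> is normal in a
  transitive group, all \<open>N\<^sub>v\<close> have the same order. If \<open>N\<^sub>v\<close> fixed every neighbour \<open>w\<close> of \<open>v\<close>,
  then \<open>N\<^sub>v = N\<^sub>w\<close>, and by connectedness \<open>N\<^sub>v\<close> would fix all vertices. So \<open>N\<^sub>v\<close> acts
  nontrivially on the three neighbours of \<open>v\<close> (\<open>stab_moves_nbr\<close>), which leaves two cases.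
  
  If \<open>N\<^sub>v\<close> fixes no neighbour of \<open>v\<close>, it is transitive on the neighbours. Vertices at distance
  two are then in the same orbit and have the same neighbourhood, so the graph is \<open>K\<^bsub>3,3\<^esub>\<close>
  (\<open>K33_if_no_fixed_nbr\<close>).
  
  Otherwise \<open>N\<^sub>v\<close> fixes exactly one neighbour of \<open>v\<close>, its mate, and swaps the other two. Mates
  form a perfect matching that \<open>G\<close> preserves, and \<open>N\<close> may be replaced by its subgroup generated
  by all the stabilisers \<open>N\<^sub>v\<close>, which has the same stabilisers. If mates share an orbit, there are
  only two orbits and the graph is \<open>K\<^sub>4\<close> (\<open>K4_if_mate_in_orbit\<close>). If they do not, then walking
  alternately along a non-matching and a matching edge visits the orbits cyclically: there is a
  cyclic sequence of \<open>r\<close> layers, each consisting of an upper orbit and the orbit of its mates,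
  and the non-matching edges lead from the upper half of a layer to the lower half of the next.
  
  Let \<open>K\<^sub>i\<close> be the stabiliser of the vertices of layer \<open>i\<close>. Consecutive \<open>K\<^sub>i\<close> meet in a subgroup of
  index two, so the products \<open>K\<^sub>i \<dots> K\<^bsub>i+j-1\<^esub>\<close> grow by a factor of at most two with \<open>j\<close>. Their
  orders do not depend on \<open>i\<close>, as \<open>G\<close> rotates the layers, so once the growth stops, the product
  is all of \<open>N\<close>. Let \<open>s\<close> be the number of doublings; \<open>s < r\<close> because \<open>r\<close> consecutive
  stabilisers generate \<open>N\<close>. Then \<open>A\<^sub>i = K\<^sub>i \<dots> K\<^bsub>i+s-1\<^esub>\<close> has index two in \<open>N\<close> and two
  orbits on the upper half of each layer from \<open>i\<close> to \<open>i + s - 1\<close>, which gives these vertices a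
  bit that is constant along the arcs between these layers. A vertex of layer \<open>x\<close> thus carries
  \<open>s\<close> bits. They determine it within that layer, since \<open>A\<^bsub>x-s+1\<^esub> \<inter> \<dots> \<inter> A\<^sub>x = K\<^sub>x\<close> (\<open>window_inter_consecutive\<close>);
  following an arc drops the oldest bit, and the two arcs out of a vertex add different new bits.
  This is the description of \<open>S(PX(2,r,s))\<close>. Here \<open>r \<ge> 2\<close>, and \<open>S(PX(2,2,1))\<close> is the cube.
\<close>

section \<open>Groups acting on cubic graphs\<close>

text \<open>
  In a finite permutation group, closure under composition already gives inverses.
\<close>

inductive_set gen :: "('a \<Rightarrow> 'a) set \<Rightarrow> ('a \<Rightarrow> 'a) set" for A where
  gen_id: "id \<in> gen A"
| gen_step: "a \<in> A \<Longrightarrow> b \<in> gen A \<Longrightarrow> a \<circ> b \<in> gen A"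

lemma gen_superset: "A \<subseteq> gen A"
  using gen_step[OF _ gen_id] by auto

lemma gen_comp:
  assumes "a \<in> gen A" "b \<in> gen A"
  shows "a \<circ> b \<in> gen A"
  using assms by (induction rule: gen.induct) (auto simp: comp_assoc intro: gen_step)

lemma gen_least:
  assumes "A \<subseteq> H" "id \<in> H" "\<And>a b. a \<in> H \<Longrightarrow> b \<in> H \<Longrightarrow> a \<circ> b \<in> H"
  shows "gen A \<subseteq> H"
proof
  fix x assume "x \<in> gen A"
  then show "x \<in> H" by induction (use assms in blast)+
qed

text \<open>
  The elements of \<open>G\<close> and \<open>N\<close> are honest permutations, the identity outside \<open>V\<close>, so that they
  compose with \<open>(\<circ>)\<close>. Connectedness says that no proper nonempty set of vertices is closed
  under adjacency, which is the form in which every argument below applies it.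
\<close>

locale cubic_action =
  fixes V :: "'a set" and adj :: "'a \<Rightarrow> 'a \<Rightarrow> bool" and G N :: "('a \<Rightarrow> 'a) set"
  assumes finite_V: "finite V"
    and adj_in_V: "adj u v \<Longrightarrow> u \<in> V"
    and adj_sym: "adj u v \<Longrightarrow> adj v u"
    and adj_irrefl: "\<not> adj v v"
    and degree_3: "v \<in> V \<Longrightarrow> card {w. adj v w} = 3"
    and connected_V: "X \<subseteq> V \<Longrightarrow> X \<noteq> {} \<Longrightarrow> (\<And>x y. x \<in> X \<Longrightarrow> adj x y \<Longrightarrow> y \<in> X) \<Longrightarrow> X = V"
    and G_permutes: "g \<in> G \<Longrightarrow> g permutes V"
    and G_adj: "g \<in> G \<Longrightarrow> adj (g u) (g v) \<longleftrightarrow> adj u v"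
    and G_transitive: "u \<in> V \<Longrightarrow> v \<in> V \<Longrightarrow> \<exists>g\<in>G. g u = v"
    and N_subset_G: "N \<subseteq> G"
    and N_normal: "g \<in> G \<Longrightarrow> n \<in> N \<Longrightarrow> \<exists>m\<in>N. g \<circ> n = m \<circ> g"
    and N_id: "id \<in> N"
    and N_comp: "m \<in> N \<Longrightarrow> n \<in> N \<Longrightarrow> m \<circ> n \<in> N"
    and N_commute: "m \<in> N \<Longrightarrow> n \<in> N \<Longrightarrow> m \<circ> n = n \<circ> m"
    and N_not_semiregular: "\<exists>v\<in>V. \<exists>n\<in>N. n v = v \<and> n \<noteq> id"
begin

definition stab :: "'a \<Rightarrow> ('a \<Rightarrow> 'a) set" where
  "stab v = {n \<in> N. n v = v}"

definition nbrs :: "'a \<Rightarrow> 'a set" where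
  "nbrs v = {w. adj v w}"

definition subgrp :: "('a \<Rightarrow> 'a) set \<Rightarrow> bool" where
  "subgrp H \<longleftrightarrow> H \<subseteq> N \<and> id \<in> H \<and> (\<forall>a\<in>H. \<forall>b\<in>H. a \<circ> b \<in> H)"

lemma adj_in_V2: "adj u v \<Longrightarrow> v \<in> V"
  using adj_in_V adj_sym by blast

lemma nbrs_in_V: "w \<in> nbrs v \<Longrightarrow> w \<in> V"
  using adj_in_V2 by (auto simp: nbrs_def)

lemma nbrs_sym: "w \<in> nbrs v \<longleftrightarrow> v \<in> nbrs w"
  using adj_sym by (auto simp: nbrs_def)

lemma nbrs_irrefl: "v \<notin> nbrs v"
  using adj_irrefl by (auto simp: nbrs_def)

lemma nbrs_card: "v \<in> V \<Longrightarrow> card (nbrs v) = 3"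
  using degree_3 by (simp add: nbrs_def)

lemma nbrs_finite: "finite (nbrs v)"
  using finite_subset[OF _ finite_V] nbrs_in_V by blast

lemma nbrs_G: "g \<in> G \<Longrightarrow> g w \<in> nbrs (g v) \<longleftrightarrow> w \<in> nbrs v"
  using G_adj by (simp add: nbrs_def)

lemma G_inj: "g \<in> G \<Longrightarrow> g u = g v \<longleftrightarrow> u = v"
  using G_permutes permutes_inj injD by metis

lemma G_surj: "g \<in> G \<Longrightarrow> \<exists>u. g u = v"
  using G_permutes permutes_surj surjD by metis

lemma G_in_V: "g \<in> G \<Longrightarrow> g v \<in> V \<longleftrightarrow> v \<in> V"
  using G_permutes permutes_in_image by metis

lemma N_in_G: "n \<in> N \<Longrightarrow> n \<in> G"
  using N_subset_G by blast

lemmas N_inj = G_inj[OF N_in_G]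
lemmas N_in_V = G_in_V[OF N_in_G]
lemmas nbrs_N = nbrs_G[OF N_in_G]

lemma N_finite: "finite N"
proof (rule finite_subset)
  show "N \<subseteq> {p. p permutes V}" using N_in_G G_permutes by blast
  show "finite {p. p permutes V}" using finite_V by (rule finite_permutations)
qed

lemma N_eq_id:
  assumes "n \<in> N" "\<And>v. v \<in> V \<Longrightarrow> n v = v"
  shows "n = id"
proof
  fix v show "n v = id v"
    using assms G_permutes[OF N_in_G] permutes_not_in by (cases "v \<in> V") fastforce+
qed

lemma N_commute_apply: "m \<in> N \<Longrightarrow> n \<in> N \<Longrightarrow> m (n v) = n (m v)"
  using N_commute by (metis comp_apply)

lemma subgrp_subset: "subgrp H \<Longrightarrow> a \<in> H \<Longrightarrow> a \<in> N"
  and subgrp_id: "subgrp H \<Longrightarrow> id \<in> H"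
  and subgrp_comp: "subgrp H \<Longrightarrow> a \<in> H \<Longrightarrow> b \<in> H \<Longrightarrow> a \<circ> b \<in> H"
  by (auto simp: subgrp_def)

lemma subgrp_inverse:
  assumes "subgrp H" "a \<in> H"
  obtains b where "b \<in> H" "a \<circ> b = id" "b \<circ> a = id"
proof -
  have "inj_on ((\<circ>) a) H"
  proof (rule inj_onI)
    fix x y assume "a \<circ> x = a \<circ> y"
    then show "x = y"
      using N_inj[OF subgrp_subset[OF assms]] by (metis comp_apply ext)
  qed
  moreover have "(\<circ>) a ` H \<subseteq> H" using subgrp_comp[OF assms(1) assms(2)] by auto
  moreover have "finite H" using assms(1) N_finite finite_subset by (auto simp: subgrp_def)
  ultimately have "(\<circ>) a ` H = H" by (simp add: endo_inj_surj)
  then obtain b where b: "b \<in> H" "a \<circ> b = id" using subgrp_id[OF assms(1)] by (metis imageE)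
  with N_commute[OF subgrp_subset subgrp_subset] assms show thesis using that by metis
qed

lemma subgrp_cancel:
  assumes "subgrp H" "a \<in> H" "b \<in> N" "a \<circ> b \<in> H"
  shows "b \<in> H"
proof -
  obtain c where c: "c \<in> H" "c \<circ> a = id" using subgrp_inverse[OF assms(1,2)] .
  have "c \<circ> (a \<circ> b) \<in> H" using subgrp_comp[OF assms(1) c(1) assms(4)] .
  then show ?thesis using c(2) by (simp flip: comp_assoc)
qed

lemma subgrp_N: "subgrp N"
  using N_id N_comp by (auto simp: subgrp_def)

lemma subgrp_stab: "subgrp (stab v)"
  using N_id N_comp by (auto simp: subgrp_def stab_def)

lemma subgrp_gen:
  assumes "A \<subseteq> N"
  shows "subgrp (gen A)"
  using gen_least[OF assms N_id N_comp] gen_id gen_comp by (auto simp: subgrp_def)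

lemma gen_subset_subgrp: "subgrp H \<Longrightarrow> A \<subseteq> H \<Longrightarrow> gen A \<subseteq> H"
  by (rule gen_least) (auto simp: subgrp_def)

lemma stab_N: "n \<in> stab v \<Longrightarrow> n \<in> N"
  and stab_fix: "n \<in> stab v \<Longrightarrow> n v = v"
  and stabI: "n \<in> N \<Longrightarrow> n v = v \<Longrightarrow> n \<in> stab v"
  by (auto simp: stab_def)

text \<open>
  For \<open>k\<close> in \<open>N\<close>, commutativity turns \<open>k (n v) = n v\<close> into \<open>n (k v) = n v\<close>.
\<close>

lemma stab_orbit: "n \<in> N \<Longrightarrow> stab (n v) = stab v"
  unfolding stab_def using N_commute_apply N_inj by (metis (no_types, lifting))

lemma stab_conj:
  assumes "g \<in> G" "n \<in> stab v"
  obtains m where "m \<in> stab (g v)" "g \<circ> n = m \<circ> g"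
proof -
  obtain m where m: "m \<in> N" "g \<circ> n = m \<circ> g" using N_normal assms stab_N by blast
  have "m (g v) = g (n v)" using m(2) by (metis comp_apply)
  then show thesis using that m stab_fix[OF assms(2)] stabI by metis
qed

text \<open>
  Conjugation by \<open>g\<close> is expressed by \<open>g \<circ> n = m \<circ> g\<close>, which avoids inverses; it is injective in \<open>n\<close>.
\<close>

lemma card_conj_le:
  assumes "g \<in> G" "B \<subseteq> N" "\<And>n. n \<in> A \<Longrightarrow> \<exists>m\<in>B. g \<circ> n = m \<circ> g"
  shows "card A \<le> card B"
proof -
  obtain f where f: "\<And>n. n \<in> A \<Longrightarrow> f n \<in> B" "\<And>n. n \<in> A \<Longrightarrow> g \<circ> n = f n \<circ> g"
    using assms(3) by metis
  have "inj_on f A"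
  proof (rule inj_onI)
    fix x y assume "x \<in> A" "y \<in> A" "f x = f y"
    then have "g \<circ> x = g \<circ> y" using f by simp
    then show "x = y" using G_inj[OF assms(1)] by (metis comp_apply ext)
  qed
  then show ?thesis
    using f(1) finite_subset[OF assms(2) N_finite] by (intro card_inj_on_le[of f]) auto
qed

lemma card_stab_eq:
  assumes "u \<in> V" "v \<in> V"
  shows "card (stab u) = card (stab v)"
proof -
  have "card (stab u) \<le> card (stab v)" if uv: "u \<in> V" "v \<in> V" for u v
  proof -
    obtain g where g: "g \<in> G" "g u = v" using G_transitive uv by blast
    show ?thesis
      by (rule card_conj_le[OF g(1)]) (use g stab_conj[OF g(1)] stab_N in blast)+
  qed
  then show ?thesis using assms by (simp add: antisym)
qed

lemma stab_finite: "finite (stab v)"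
  using N_finite by (simp add: stab_def)

text \<open>
  All stabilisers have the same order, so an inclusion between two of them is an equality.
\<close>

lemma stab_eqI:
  assumes "u \<in> V" "v \<in> V" "stab u \<subseteq> stab v"
  shows "stab u = stab v"
  using card_subset_eq[OF stab_finite assms(3)] card_stab_eq[OF assms(1,2)] by simp

lemma stab_nbrs: "n \<in> stab v \<Longrightarrow> n w \<in> nbrs v \<longleftrightarrow> w \<in> nbrs v"
  using nbrs_N[OF stab_N] stab_fix by metis

text \<open>
  If some stabiliser fixed the whole neighbourhood of its vertex, then by transitivity all would.
  Stabilisers of adjacent vertices would then be equal, hence all of them, and their
  common elements would fix every vertex.
\<close>

lemma stab_moves_nbr:
  assumes "v \<in> V"
  shows "\<exists>n\<in>stab v. \<exists>w\<in>nbrs v. n w \<noteq> w"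
proof (rule ccontr)
  assume no: "\<not> ?thesis"
  have triv: "n w = w" if u: "u \<in> V" and n: "n \<in> stab u" and w: "w \<in> nbrs u" for u n w
  proof -
    obtain g where g: "g \<in> G" "g u = v" using G_transitive u assms by blast
    obtain m where m: "m \<in> stab (g u)" "g \<circ> n = m \<circ> g" using stab_conj g n by metis
    have "g w \<in> nbrs v" using nbrs_G g w by metis
    then have "m (g w) = g w" using no m g by blast
    then have "g (n w) = g w" using m(2) by (metis comp_apply)
    then show ?thesis using G_inj g by blast
  qed
  have "{u \<in> V. stab u = stab v} = V"
  proof (rule connected_V)
    fix x y assume x: "x \<in> {u \<in> V. stab u = stab v}" and a: "adj x y"
    have "stab x \<subseteq> stab y" using triv[of x _ y] x a by (auto simp: nbrs_def stab_def)
    then have "stab x = stab y" using stab_eqI[of x y] x adj_in_V2[OF a] by blast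
    then show "y \<in> {u \<in> V. stab u = stab v}" using x adj_in_V2[OF a] by auto
  qed (use assms in auto)
  then have "n = id" if "n \<in> stab u" "u \<in> V" for n u
    using that by (intro N_eq_id) (auto simp: stab_def)
  then show False using N_not_semiregular by (auto simp: stab_def)
qed

text \<open>
  Three points cannot be divided into two or more orbits of size at least two.
\<close>

lemma stab_transitive_on_nbrs:
  assumes "v \<in> V" and none: "\<forall>w\<in>nbrs v. \<exists>n\<in>stab v. n w \<noteq> w" and w: "w \<in> nbrs v" "w' \<in> nbrs v"
  shows "\<exists>n\<in>stab v. n w = w'"
proof (rule ccontr)
  assume no: "\<not> ?thesis"
  define orb where "orb = (\<lambda>x. (\<lambda>n. n x) ` stab v)"
  have orb_sub: "orb x \<subseteq> nbrs v" if "x \<in> nbrs v" for x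
    using that stab_nbrs by (auto simp: orb_def)
  have orb2: "card (orb x) \<ge> 2" if x: "x \<in> nbrs v" for x
  proof -
    obtain n where n: "n \<in> stab v" "n x \<noteq> x" using none x by blast
    have "{x, n x} \<subseteq> orb x"
      using n subgrp_id[OF subgrp_stab, of v] unfolding orb_def by (force intro: image_eqI[of _ _ id])
    then have "card {x, n x} \<le> card (orb x)"
      using finite_subset[OF orb_sub[OF x] nbrs_finite] by (rule card_mono[rotated])
    then show ?thesis using n by simp
  qed
  have "orb w \<inter> orb w' = {}"
  proof (rule ccontr)
    assume "orb w \<inter> orb w' \<noteq> {}"
    then obtain m n where mn: "m \<in> stab v" "n \<in> stab v" "m w = n w'" by (auto simp: orb_def)
    obtain b where b: "b \<in> stab v" "b \<circ> n = id" using subgrp_inverse[OF subgrp_stab mn(2)] .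
    have "(b \<circ> m) w = w'" using mn(3) b(2) by (metis comp_apply id_apply)
    then show False using no subgrp_comp[OF subgrp_stab b(1) mn(1)] by blast
  qed
  then have "card (orb w \<union> orb w') = card (orb w) + card (orb w')"
    using orb_sub w nbrs_finite finite_subset by (intro card_Un_disjoint) blast+
  moreover have "card (orb w \<union> orb w') \<le> card (nbrs v)"
    using orb_sub w nbrs_finite by (intro card_mono) auto
  ultimately show False using orb2[OF w(1)] orb2[OF w(2)] nbrs_card[OF assms(1)] by linarith
qed

text \<open>
  Let \<open>w\<close> be a neighbour of \<open>v\<close>. Every neighbour \<open>u\<close> of \<open>w\<close> is an image of \<open>v\<close> under \<open>stab w\<close>, so it
  is fixed by \<open>stab v\<close>, which moves the edge \<open>uw\<close> onto an edge from \<open>u\<close> to any neighbour of \<open>v\<close>.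
\<close>

lemma K33_if_no_fixed_nbr:
  assumes "v \<in> V" and none: "\<forall>w\<in>nbrs v. \<exists>n\<in>stab v. n w \<noteq> w"
  obtains A B where "V = A \<union> B" "A \<inter> B = {}" "card A = 3" "card B = 3"
    "\<And>x y. adj x y \<longleftrightarrow> x \<in> A \<and> y \<in> B \<or> x \<in> B \<and> y \<in> A"
proof -
  have none': "\<forall>w\<in>nbrs u. \<exists>n\<in>stab u. n w \<noteq> w" if u: "u \<in> V" for u
  proof
    fix w assume w: "w \<in> nbrs u"
    obtain g where g: "g \<in> G" "g v = u" using G_transitive assms u by blast
    obtain w0 where w0: "g w0 = w" using G_surj g by blast
    then have "w0 \<in> nbrs v" using w g nbrs_G by blast
    then obtain n where n: "n \<in> stab v" "n w0 \<noteq> w0" using none by blast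
    obtain m where m: "m \<in> stab (g v)" "g \<circ> n = m \<circ> g" using stab_conj g n by metis
    have "m (g w0) = g (n w0)" using m(2) by (metis comp_apply)
    then show "\<exists>n\<in>stab u. n w \<noteq> w" using m(1) g w0 n(2) G_inj by metis
  qed
  note trans = stab_transitive_on_nbrs[OF _ none']
  obtain w where w: "w \<in> nbrs v" using nbrs_card[OF assms(1)] by fastforce
  have wV: "w \<in> V" using w nbrs_in_V by blast
  have vw: "v \<in> nbrs w" using w nbrs_sym by blast
  \<comment> \<open>Any vertex at distance two from \<open>v\<close> lies in the orbit of \<open>v\<close>, so it is fixed by \<open>stab v\<close>.\<close>
  have same: "nbrs u = nbrs v" if u: "u \<in> nbrs w" for u
  proof -
    have uV: "u \<in> V" using u nbrs_in_V by blast
    obtain k where k: "k \<in> stab w" "k v = u" using trans[OF wV wV vw u] by blast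
    have S: "stab u = stab v" using stab_orbit[OF stab_N[OF k(1)], of v] k(2) by simp
    have "nbrs v \<subseteq> nbrs u"
    proof
      fix x assume x: "x \<in> nbrs v"
      obtain n where n: "n \<in> stab v" "n w = x" using trans[OF assms(1) assms(1) w x] by blast
      have "w \<in> nbrs u" using u nbrs_sym by blast
      then show "x \<in> nbrs u" using stab_nbrs[of n u w] n S by simp
    qed
    then show ?thesis
      using card_subset_eq[OF nbrs_finite] nbrs_card uV assms(1) by metis
  qed
  define A B where "A = nbrs w" and "B = nbrs v"
  have same': "nbrs x = A" if "x \<in> B" for x
  proof -
    have "A \<subseteq> nbrs x" using same that nbrs_sym by (auto simp: A_def B_def)
    moreover have "x \<in> V" using that nbrs_in_V B_def by blast
    ultimately show ?thesis
      using card_subset_eq[OF nbrs_finite, of A x] nbrs_card wV by (simp add: A_def)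
  qed
  have sameA: "nbrs x = B" if "x \<in> A" for x using same that by (simp add: A_def B_def)
  have disj: "A \<inter> B = {}" using same' sameA nbrs_irrefl by blast
  have "A \<union> B = V"
  proof (rule connected_V)
    show "A \<union> B \<subseteq> V" using nbrs_in_V by (auto simp: A_def B_def)
    show "A \<union> B \<noteq> {}" using w by (auto simp: B_def)
    show "y \<in> A \<union> B" if "x \<in> A \<union> B" "adj x y" for x y
      using that same' sameA by (auto simp: nbrs_def)
  qed
  moreover have "adj x y \<longleftrightarrow> x \<in> A \<and> y \<in> B \<or> x \<in> B \<and> y \<in> A" for x y
    using same' sameA disj \<open>A \<union> B = V\<close> adj_in_V[of x y] nbrs_def by blast
  ultimately show thesis
    using that[of A B] disj nbrs_card assms(1) wV by (auto simp: A_def B_def)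
qed

end

section \<open>The matching fixed by the stabilisers\<close>

text \<open>
  The assumption \<open>generated\<close> says that the vertex stabilisers generate \<open>N\<close>. It makes the orbits of
  \<open>N\<close> as small as possible, and it will bound the number of labels by the number of layers.
\<close>

locale cubic_action_matched = cubic_action +
  assumes fixed_nbr: "v \<in> V \<Longrightarrow> \<exists>w\<in>nbrs v. \<forall>n\<in>stab v. n w = w"
    and generated: "subgrp H \<Longrightarrow> (\<And>v. v \<in> V \<Longrightarrow> stab v \<subseteq> H) \<Longrightarrow> H = N"
begin

definition mate :: "'a \<Rightarrow> 'a" where
  "mate v = (THE w. w \<in> nbrs v \<and> (\<forall>n\<in>stab v. n w = w))"

text \<open>
  Removing the matching leaves a disjoint union of cycles, in which \<open>cnbrs v\<close> are the two neighbours
  of \<open>v\<close>.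
\<close>

definition cnbrs :: "'a \<Rightarrow> 'a set" where
  "cnbrs v = nbrs v - {mate v}"

text \<open>
  A permutation of three points that fixes two of them is trivial.
\<close>

lemma fixed_nbr_unique:
  assumes v: "v \<in> V" and w: "w1 \<in> nbrs v" "w2 \<in> nbrs v"
    and fxd: "\<forall>n\<in>stab v. n w1 = w1" "\<forall>n\<in>stab v. n w2 = w2"
  shows "w1 = w2"
proof (rule ccontr)
  assume ne: "w1 \<noteq> w2"
  obtain n w where n: "n \<in> stab v" "w \<in> nbrs v" "n w \<noteq> w" using stab_moves_nbr[OF v] by blast
  have "w \<noteq> w1" "w \<noteq> w2" using n fxd by auto
  moreover have "n w \<noteq> n w1" "n w \<noteq> n w2" using calculation N_inj[OF stab_N[OF n(1)]] by auto
  then have "n w \<noteq> w1" "n w \<noteq> w2" using fxd n by auto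
  moreover have "n w \<in> nbrs v" using stab_nbrs n by blast
  ultimately have "{w1, w2, w, n w} \<subseteq> nbrs v" "card {w1, w2, w, n w} = 4" using n w ne by auto
  then show False using card_mono[OF nbrs_finite, of "{w1, w2, w, n w}" v] nbrs_card[OF v] by simp
qed

lemma
  assumes v: "v \<in> V"
  shows mate_in_nbrs: "mate v \<in> nbrs v"
    and mate_fixed: "n \<in> stab v \<Longrightarrow> n (mate v) = mate v"
proof -
  have "\<exists>!w. w \<in> nbrs v \<and> (\<forall>n\<in>stab v. n w = w)"
    using fixed_nbr[OF v] fixed_nbr_unique[OF v] by blast
  then have "mate v \<in> nbrs v \<and> (\<forall>n\<in>stab v. n (mate v) = mate v)"
    unfolding mate_def by (rule theI')
  then show "mate v \<in> nbrs v" "n \<in> stab v \<Longrightarrow> n (mate v) = mate v" by blast+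
qed

lemma mate_eqI: "v \<in> V \<Longrightarrow> w \<in> nbrs v \<Longrightarrow> (\<And>n. n \<in> stab v \<Longrightarrow> n w = w) \<Longrightarrow> mate v = w"
  using fixed_nbr_unique mate_in_nbrs mate_fixed by blast

lemma mate_in_V: "v \<in> V \<Longrightarrow> mate v \<in> V"
  using mate_in_nbrs nbrs_in_V by blast

lemma stab_mate:
  assumes "v \<in> V"
  shows "stab (mate v) = stab v"
proof -
  have "stab v \<subseteq> stab (mate v)" using mate_fixed[OF assms] stabI stab_N by blast
  then show ?thesis using stab_eqI[OF assms mate_in_V[OF assms]] by blast
qed

lemma mate_mate: "v \<in> V \<Longrightarrow> mate (mate v) = v"
  using mate_eqI[OF mate_in_V] mate_in_nbrs nbrs_sym stab_mate stab_fix by metis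

lemma mate_ne: "v \<in> V \<Longrightarrow> mate v \<noteq> v"
  using mate_in_nbrs nbrs_irrefl by metis

lemma mate_inj: "u \<in> V \<Longrightarrow> v \<in> V \<Longrightarrow> mate u = mate v \<longleftrightarrow> u = v"
  using mate_mate by metis

text \<open>
  The mate of \<open>v\<close> is defined from \<open>stab v\<close> and the graph alone, and \<open>g\<close> conjugates \<open>stab v\<close> onto
  \<open>stab (g v)\<close>.
\<close>

lemma mate_G:
  assumes "g \<in> G" "v \<in> V"
  shows "mate (g v) = g (mate v)"
proof (rule mate_eqI)
  show "g v \<in> V" using assms G_in_V by blast
  show "g (mate v) \<in> nbrs (g v)" using assms nbrs_G mate_in_nbrs by blast
  fix m assume m: "m \<in> stab (g v)"
  \<comment> \<open>\<open>m\<close> is the conjugate of an element of \<open>stab v\<close>, because both stabilisers have the same order.\<close>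
  obtain f where f: "\<And>n. n \<in> stab v \<Longrightarrow> f n \<in> stab (g v)" "\<And>n. n \<in> stab v \<Longrightarrow> g \<circ> n = f n \<circ> g"
  proof -
    have "\<forall>n\<in>stab v. \<exists>m. m \<in> stab (g v) \<and> g \<circ> n = m \<circ> g"
      using stab_conj[OF assms(1)] by blast
    then show thesis using that by (auto dest!: bchoice)
  qed
  have "inj_on f (stab v)"
  proof (rule inj_onI)
    fix x y assume "x \<in> stab v" "y \<in> stab v" "f x = f y"
    then have "g \<circ> x = g \<circ> y" using f by simp
    then show "x = y" using G_inj[OF assms(1)] by (metis comp_apply ext)
  qed
  then have "card (f ` stab v) = card (stab (g v))"
    using card_image card_stab_eq[OF assms(2), of "g v"] assms G_in_V by metis
  then have "f ` stab v = stab (g v)" using f(1) stab_finite by (intro card_subset_eq) auto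
  then obtain n where n: "n \<in> stab v" "m = f n" using m by blast
  then have "m (g (mate v)) = g (n (mate v))" using f(2) by (metis comp_apply)
  then show "m (g (mate v)) = g (mate v)" using mate_fixed[OF assms(2) n(1)] by simp
qed

lemmas mate_N = mate_G[OF N_in_G]

lemma cnbrs_nbrs: "w \<in> cnbrs v \<Longrightarrow> w \<in> nbrs v"
  by (simp add: cnbrs_def)

lemma cnbrs_in_V: "w \<in> cnbrs v \<Longrightarrow> w \<in> V"
  using cnbrs_nbrs nbrs_in_V by blast

lemma nbrs_cases: "w \<in> nbrs v \<Longrightarrow> w = mate v \<or> w \<in> cnbrs v"
  by (simp add: cnbrs_def)

lemma cnbrs_finite: "finite (cnbrs v)"
  using nbrs_finite by (simp add: cnbrs_def)

lemma cnbrs_card: "v \<in> V \<Longrightarrow> card (cnbrs v) = 2"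
  using nbrs_card mate_in_nbrs nbrs_finite by (simp add: cnbrs_def)

lemma cnbrs_nonempty: "v \<in> V \<Longrightarrow> \<exists>w. w \<in> cnbrs v"
  using cnbrs_card by (metis card.empty ex_in_conv zero_neq_numeral)

lemma cnbrs_sym: "v \<in> V \<Longrightarrow> w \<in> cnbrs v \<Longrightarrow> v \<in> cnbrs w"
  using nbrs_sym[of w v] nbrs_in_V[of w v] mate_mate[of w] by (auto simp: cnbrs_def)

lemma cnbrs_G: "g \<in> G \<Longrightarrow> v \<in> V \<Longrightarrow> g w \<in> cnbrs (g v) \<longleftrightarrow> w \<in> cnbrs v"
  using nbrs_G[of g w v] mate_G[of g v] G_inj[of g w "mate v"] by (auto simp: cnbrs_def)

lemmas cnbrs_N = cnbrs_G[OF N_in_G]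

lemma stab_cnbrs: "n \<in> stab v \<Longrightarrow> v \<in> V \<Longrightarrow> n w \<in> cnbrs v \<longleftrightarrow> w \<in> cnbrs v"
  using cnbrs_N[OF stab_N] stab_fix by metis

lemma cnbrs_two:
  assumes "v \<in> V" "a \<in> cnbrs v" "b \<in> cnbrs v" "a \<noteq> b" "c \<in> cnbrs v"
  shows "c = a \<or> c = b"
proof (rule ccontr)
  assume "\<not> ?thesis"
  then have "card {a, b, c} = 3" using assms by auto
  moreover have "card {a, b, c} \<le> card (cnbrs v)" using assms cnbrs_finite by (intro card_mono) auto
  ultimately show False using cnbrs_card[OF assms(1)] by simp
qed

lemma cnbrs_other:
  assumes "v \<in> V" "a \<in> cnbrs v"
  obtains b where "b \<in> cnbrs v" "b \<noteq> a"
proof -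
  have "cnbrs v \<noteq> {a}" using cnbrs_card[OF assms(1)] by auto
  then obtain b where "b \<in> cnbrs v" "b \<noteq> a" using assms(2) by auto
  then show thesis by (rule that)
qed

lemma stab_swaps_cnbrs:
  assumes "v \<in> V" "a \<in> cnbrs v" "b \<in> cnbrs v"
  shows "\<exists>n\<in>stab v. n a = b"
proof (cases "a = b")
  case True
  then show ?thesis using subgrp_id[OF subgrp_stab, of v] by (intro bexI[of _ id]) auto
next
  case False
  obtain n w where n: "n \<in> stab v" "w \<in> nbrs v" "n w \<noteq> w"
    using stab_moves_nbr[OF assms(1)] by blast
  then have w: "w \<in> cnbrs v" using mate_fixed[OF assms(1)] nbrs_cases by metis
  have nC: "n a \<in> cnbrs v" "n b \<in> cnbrs v" "n w \<in> cnbrs v"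
    using stab_cnbrs n assms w by blast+
  show ?thesis
  proof (cases "w = a")
    case True
    then show ?thesis using cnbrs_two[OF assms False nC(3)] n by auto
  next
    case F: False
    then have "w = b" using cnbrs_two[OF assms False w] by blast
    then have "n b = a" using cnbrs_two[OF assms False nC(3)] n by auto
    moreover have "n a \<noteq> n b" using N_inj stab_N n False by blast
    ultimately show ?thesis using cnbrs_two[OF assms False nC(1)] n by auto
  qed
qed

lemma stab_moves_cnbr:
  assumes "v \<in> V" "a \<in> cnbrs v"
  obtains n where "n \<in> stab v" "n a \<noteq> a"
proof -
  obtain b where b: "b \<in> cnbrs v" "b \<noteq> a" using cnbrs_other[OF assms] .
  then show thesis using stab_swaps_cnbrs[OF assms b(1)] that by blast
qed

definition same_orbit :: "'a \<Rightarrow> 'a \<Rightarrow> bool" (infix "\<approx>" 50) where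
  "u \<approx> v \<longleftrightarrow> (\<exists>n\<in>N. v = n u)"

lemma orbit_refl: "v \<approx> v"
  using N_id by (auto simp: same_orbit_def intro: bexI[of _ id])

lemma orbit_sym:
  assumes "u \<approx> v"
  shows "v \<approx> u"
proof -
  obtain n where n: "n \<in> N" "v = n u" using assms by (auto simp: same_orbit_def)
  obtain m where "m \<in> N" "m \<circ> n = id" using subgrp_inverse[OF subgrp_N n(1)] .
  then show ?thesis using n(2) by (metis same_orbit_def comp_apply id_apply)
qed

lemma orbit_trans: "u \<approx> v \<Longrightarrow> v \<approx> w \<Longrightarrow> u \<approx> w"
  unfolding same_orbit_def using N_comp by (metis comp_apply)

lemma orbit_in_V: "u \<approx> v \<Longrightarrow> u \<in> V \<longleftrightarrow> v \<in> V"
  unfolding same_orbit_def using N_in_V by auto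

lemma orbit_stab: "u \<approx> v \<Longrightarrow> stab u = stab v"
  unfolding same_orbit_def using stab_orbit by auto

lemma orbit_G: "g \<in> G \<Longrightarrow> u \<approx> v \<Longrightarrow> g u \<approx> g v"
  unfolding same_orbit_def using N_normal by (metis comp_apply)

lemma orbit_mate: "u \<in> V \<Longrightarrow> u \<approx> v \<Longrightarrow> mate u \<approx> mate v"
  unfolding same_orbit_def using mate_N by metis

lemma orbit_mate_iff: "u \<in> V \<Longrightarrow> v \<in> V \<Longrightarrow> mate u \<approx> v \<longleftrightarrow> u \<approx> mate v"
  using orbit_mate mate_mate mate_in_V by metis

text \<open>
  The two cycle neighbours of a vertex are swapped by its stabiliser, so the orbit of a vertex
  determines the orbit of its cycle neighbours.
\<close>

lemma orbit_cnbrs: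
  assumes "u \<in> V" "u \<approx> v" "a \<in> cnbrs u" "b \<in> cnbrs v"
  shows "a \<approx> b"
proof -
  obtain n where n: "n \<in> N" "v = n u" using assms(2) by (auto simp: same_orbit_def)
  then have "n a \<in> cnbrs v" using cnbrs_N assms by blast
  then obtain k where "k \<in> stab v" "k (n a) = b"
    using stab_swaps_cnbrs assms orbit_in_V by metis
  then have "b = (k \<circ> n) a" "k \<circ> n \<in> N" using N_comp stab_N n by auto
  then show ?thesis unfolding same_orbit_def by blast
qed

text \<open>
  Vertices of one orbit have the same stabiliser, but the stabiliser of \<open>v\<close> moves the cycle
  neighbours of \<open>v\<close>.
\<close>

lemma cnbr_not_same_orbit:
  assumes "v \<in> V" "a \<in> cnbrs v"
  shows "\<not> a \<approx> v"
proof
  assume "a \<approx> v"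
  then have "stab a = stab v" by (rule orbit_stab)
  moreover obtain n where "n \<in> stab v" "n a \<noteq> a" using stab_moves_cnbr[OF assms] .
  ultimately show False using stab_fix[of n a] by simp
qed

text \<open>
  Let \<open>a\<close> be a cycle neighbour of \<open>v\<close>. The orbits of \<open>v\<close> and \<open>a\<close> are then closed under adjacency, so
  they cover \<open>V\<close>, and \<open>N\<close> is the product of \<open>stab v\<close> and \<open>stab a\<close>. Hence the orbit of \<open>v\<close> is the orbit
  of \<open>v\<close> under \<open>stab a\<close>, which consists of the two cycle neighbours of \<open>a\<close>; likewise for \<open>a\<close>.
\<close>

lemma K4_if_mate_in_orbit:
  assumes "v \<in> V" "mate v \<approx> v"
  shows "card V = 4 \<and> (\<forall>x\<in>V. \<forall>y\<in>V. adj x y \<longleftrightarrow> x \<noteq> y)"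
proof -
  obtain a where a: "a \<in> cnbrs v" using cnbrs_nonempty assms by blast
  have aV: "a \<in> V" and va: "v \<in> cnbrs a" using a cnbrs_in_V cnbrs_sym assms by blast+
  obtain g where g: "g \<in> G" "g v = a" using G_transitive assms aV by blast
  have ma: "mate a \<approx> a" using orbit_G[OF g(1) assms(2)] mate_G[OF g(1) assms(1)] g(2) by simp
  have "{x \<in> V. x \<approx> v \<or> x \<approx> a} = V"
  proof (rule connected_V)
    fix x y assume x: "x \<in> {x \<in> V. x \<approx> v \<or> x \<approx> a}" and "adj x y"
    then have "y \<in> nbrs x" by (simp add: nbrs_def)
    then have "y = mate x \<or> y \<in> cnbrs x" by (rule nbrs_cases)
    moreover have "mate x \<approx> v \<or> mate x \<approx> a"
      using x orbit_mate[of x v] orbit_mate[of x a] orbit_trans[OF _ assms(2)] orbit_trans[OF _ ma] by auto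
    moreover have "y \<approx> v \<or> y \<approx> a" if "y \<in> cnbrs x"
      using x orbit_cnbrs[OF _ _ that a] orbit_cnbrs[OF _ _ that va] by blast
    ultimately have "y \<approx> v \<or> y \<approx> a" by auto
    then show "y \<in> {x \<in> V. x \<approx> v \<or> x \<approx> a}" using adj_in_V2 \<open>adj x y\<close> by blast
  qed (use assms orbit_refl in auto)
  then have two: "x \<approx> v \<or> x \<approx> a" if "x \<in> V" for x using that by blast
  define H where "H = (\<lambda>(k, l). k \<circ> l) ` (stab v \<times> stab a)"
  have HI: "k \<circ> l \<in> H" if "k \<in> stab v" "l \<in> stab a" for k l using that by (auto simp: H_def)
  have "subgrp H" unfolding subgrp_def
  proof (intro conjI ballI)
    show "H \<subseteq> N" using stab_N N_comp by (auto simp: H_def)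
    show "id \<in> H" using HI[OF subgrp_id[OF subgrp_stab] subgrp_id[OF subgrp_stab]] by simp
    fix x y assume "x \<in> H" "y \<in> H"
    then obtain k l k' l' where *: "x = k \<circ> l" "y = k' \<circ> l'" "k \<in> stab v" "l \<in> stab a"
      "k' \<in> stab v" "l' \<in> stab a" by (auto simp: H_def)
    have "x \<circ> y = k \<circ> (l \<circ> k') \<circ> l'" using * by (simp add: comp_assoc)
    also have "\<dots> = (k \<circ> k') \<circ> (l \<circ> l')" using N_commute[of l k'] * stab_N by (metis comp_assoc)
    finally show "x \<circ> y \<in> H" using HI subgrp_comp[OF subgrp_stab] * by metis
  qed
  moreover have "stab x \<subseteq> H" if "x \<in> V" for x
  proof -
    have "stab x = stab v \<or> stab x = stab a" using two[OF that] orbit_stab by blast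
    moreover have "stab v \<subseteq> H" using HI[OF _ subgrp_id[OF subgrp_stab]] by auto
    moreover have "stab a \<subseteq> H" using HI[OF subgrp_id[OF subgrp_stab]] by auto
    ultimately show ?thesis by auto
  qed
  ultimately have HN: "H = N" by (rule generated)
  have orb: "x = v \<or> x \<in> cnbrs a" if x: "x \<approx> v" for x
  proof -
    obtain n where n: "n \<in> N" "x = n v" using orbit_sym[OF x] by (auto simp: same_orbit_def)
    then have "n \<in> H" using HN by simp
    then obtain k l where kl: "n = k \<circ> l" "k \<in> stab v" "l \<in> stab a" by (auto simp: H_def)
    have "x = l (k v)" using n kl N_commute_apply stab_N by (metis comp_apply)
    then have "x = l v" using kl stab_fix by metis
    then show ?thesis using stab_cnbrs[OF kl(3) aV] va by blast
  qed
  have orba: "x = a \<or> x \<in> cnbrs v" if x: "x \<approx> a" for x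
  proof -
    obtain n where n: "n \<in> N" "x = n a" using orbit_sym[OF x] by (auto simp: same_orbit_def)
    then have "n \<in> H" using HN by simp
    then obtain k l where kl: "n = k \<circ> l" "k \<in> stab v" "l \<in> stab a" by (auto simp: H_def)
    have "x = k (l a)" using n kl by simp
    then have "x = k a" using kl stab_fix by metis
    then show ?thesis using stab_cnbrs[OF kl(2) assms(1)] a by blast
  qed
  have mva: "mate v \<in> cnbrs a" using orb[OF assms(2)] mate_ne assms by blast
  have mav: "mate a \<in> cnbrs v" using orba[OF ma] mate_ne aV by blast
  have Ca: "x \<in> cnbrs a \<longleftrightarrow> x = v \<or> x = mate v" for x
    using cnbrs_two[OF aV va mva] mate_ne[OF assms(1)] va mva by metis
  have Cv: "x \<in> cnbrs v \<longleftrightarrow> x = a \<or> x = mate a" for x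
    using cnbrs_two[OF assms(1) a mav] mate_ne[OF aV] a mav by metis
  let ?X = "{v, mate v, a, mate a}"
  have "V \<subseteq> ?X" using two orb orba Ca Cv by blast
  then have VX: "V = ?X" using assms aV mate_in_V by blast
  have "v \<noteq> a" using a nbrs_irrefl cnbrs_nbrs by blast
  moreover have "v \<noteq> mate v" "a \<noteq> mate a" using mate_ne[OF assms(1)] mate_ne[OF aV] by metis+
  moreover have "a \<noteq> mate v" "mate a \<noteq> mate v" using a mav by (auto simp: cnbrs_def)
  moreover have "v \<noteq> mate a" using mate_mate[OF aV] calculation(4) by metis
  ultimately have dist: "distinct [v, mate v, a, mate a]" by auto
  then have c4: "card V = 4" using VX by simp
  have "adj x y \<longleftrightarrow> x \<noteq> y" if x: "x \<in> V" "y \<in> V" for x y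
  proof -
    have "nbrs x \<subseteq> V - {x}" using nbrs_in_V nbrs_irrefl by blast
    moreover have "card (V - {x}) = card (nbrs x)" using c4 x nbrs_card finite_V by simp
    ultimately have "nbrs x = V - {x}" using finite_V by (intro card_subset_eq) auto
    then show ?thesis using x by (auto simp: nbrs_def)
  qed
  then show ?thesis using c4 by blast
qed

end

section \<open>The cyclic sequence of layers\<close>

locale cubic_action_ladder = cubic_action_matched +
  assumes mate_other_orbit: "v \<in> V \<Longrightarrow> \<not> mate v \<approx> v"
begin

text \<open>
  Contracting the matching gives a graph of valency four, and \<open>arc\<close> orients it: a vertex stands
  for itself and its mate, and \<open>arc u v\<close> leaves \<open>u\<close> along a cycle edge and continues along a matching
  edge to \<open>v\<close>.
\<close>

definition arc :: "'a \<Rightarrow> 'a \<Rightarrow> bool" where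
  "arc u v \<longleftrightarrow> u \<in> V \<and> v \<in> V \<and> mate v \<in> cnbrs u"

lemma arc_V: "arc u v \<Longrightarrow> u \<in> V" "arc u v \<Longrightarrow> v \<in> V" "arc u v \<Longrightarrow> mate v \<in> cnbrs u"
  by (auto simp: arc_def)

lemma cnbrs_arc: "u \<in> V \<Longrightarrow> a \<in> cnbrs u \<Longrightarrow> arc u (mate a)"
  using cnbrs_in_V[of a u] mate_in_V[of a] mate_mate[of a] by (simp add: arc_def)

lemma arc_ex: "u \<in> V \<Longrightarrow> \<exists>v. arc u v"
  using cnbrs_arc cnbrs_nonempty by blast

lemma arc_back: "arc u v \<Longrightarrow> u \<in> cnbrs (mate v)"
  using cnbrs_sym by (simp add: arc_def)

text \<open>
  The cycle edge between \<open>u\<close> and \<open>mate v\<close> is traversed from its other end, and \<open>u\<close> is matched to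
  \<open>mate u\<close>.
\<close>

lemma arc_flip: "arc u v \<Longrightarrow> arc (mate v) (mate u)"
  using arc_back mate_in_V mate_mate by (simp add: arc_def)

lemma arc_out_orbit:
  assumes "arc u v" "arc u v'"
  shows "\<exists>n\<in>stab u. n v = v'"
proof -
  obtain n where n: "n \<in> stab u" "n (mate v) = mate v'"
    using stab_swaps_cnbrs[OF arc_V(1,3)[OF assms(1)] arc_V(3)[OF assms(2)]] by blast
  have "mate (n v) = mate v'" using mate_N[OF stab_N[OF n(1)] arc_V(2)[OF assms(1)]] n(2) by simp
  then have "n v = v'" using mate_inj N_in_V[OF stab_N[OF n(1)]] arc_V(2) assms by blast
  then show ?thesis using n(1) by blast
qed

lemma arc_out_two:
  assumes "arc u v" "arc u a" "arc u b" "a \<noteq> v" "b \<noteq> v"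
  shows "a = b"
proof -
  have "mate a \<noteq> mate v" "mate b \<noteq> mate v" using assms mate_inj arc_V(2) by metis+
  then have "mate a = mate b"
    using cnbrs_two[of u "mate v" "mate a" "mate b"] arc_V assms by metis
  then show ?thesis using mate_inj arc_V(2) assms by metis
qed

lemma arc_G:
  assumes "g \<in> G" "arc u v"
  shows "arc (g u) (g v)"
  using arc_V[OF assms(2)] mate_G[OF assms(1)] cnbrs_G[OF assms(1)] G_in_V[OF assms(1)]
  by (simp add: arc_def)

lemmas arc_N = arc_G[OF N_in_G]

lemma arc_moves_out:
  assumes "arc u v"
  obtains n where "n \<in> stab u" "n v \<noteq> v"
proof -
  obtain n where n: "n \<in> stab u" "n (mate v) \<noteq> mate v"
    using stab_moves_cnbr[OF arc_V(1,3)[OF assms]] .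
  then have "n v \<noteq> v" using mate_N[OF stab_N[OF n(1)] arc_V(2)[OF assms]] by auto
  then show thesis using that n by blast
qed

lemma arc_moves_in:
  assumes "arc u v"
  obtains n where "n \<in> stab v" "n u \<noteq> u"
proof -
  obtain n where "n \<in> stab (mate v)" "n u \<noteq> u"
    using stab_moves_cnbr[OF mate_in_V[OF arc_V(2)[OF assms]] arc_back[OF assms]] .
  then show thesis using that stab_mate[OF arc_V(2)[OF assms]] by auto
qed

text \<open>
  The two elements swap the same two arcs out of \<open>u\<close>, so they cancel on \<open>v\<close>: the subgroup
  \<open>stab u \<inter> stab v\<close> has index two in \<open>stab u\<close>.
\<close>

lemma arc_stab_comp:
  assumes "arc u v" "m \<in> stab u" "n \<in> stab u" "m v \<noteq> v" "n v \<noteq> v"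
  shows "m \<circ> n \<in> stab v"
proof -
  have a: "arc u (k v)" if "k \<in> stab u" for k
    using arc_N[OF stab_N[OF that] assms(1)] stab_fix[OF that] by simp
  have mn: "m \<circ> n \<in> stab u" using subgrp_comp[OF subgrp_stab] assms by blast
  have "m (n v) \<noteq> m v" using N_inj[OF stab_N[OF assms(2)]] assms(5) by blast
  then have "(m \<circ> n) v = v"
    using arc_out_two[OF assms(1) a[OF mn] a[OF assms(2)]] assms(4) by auto
  then show ?thesis using stabI[OF stab_N[OF mn]] by blast
qed

lemma arc_orbit:
  assumes "arc u v" "arc u' v'" "u \<approx> u'"
  shows "v \<approx> v'"
proof -
  have "mate v \<approx> mate v'"
    using orbit_cnbrs[OF arc_V(1)[OF assms(1)] assms(3)] arc_V(3) assms by blast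
  then have "mate (mate v) \<approx> mate (mate v')"
    using orbit_mate mate_in_V arc_V(2) assms by blast
  then show ?thesis using mate_mate arc_V(2) assms by simp
qed

lemma arc_orbit_back:
  assumes "arc u v" "arc u' v'" "v \<approx> v'"
  shows "u \<approx> u'"
  using orbit_cnbrs[OF _ orbit_mate[OF _ assms(3)]] arc_back mate_in_V arc_V(2) assms by blast

text \<open>
  An arbitrary infinite walk along the arcs. Modulo \<open>N\<close> it is periodic, but the vertices
  \<open>walk (i + r)\<close> and \<open>walk i\<close> may differ.
\<close>

primrec walk :: "nat \<Rightarrow> 'a" where
  "walk 0 = (SOME v. v \<in> V)"
| "walk (Suc i) = (SOME v. arc (walk i) v)"

lemma walk_V: "walk i \<in> V"
proof (induction i)
  case 0
  then show ?case using N_not_semiregular by (auto intro: someI)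
next
  case (Suc i)
  have "arc (walk i) (walk (Suc i))" using someI_ex[OF arc_ex[OF Suc]] by simp
  then show ?case by (rule arc_V(2))
qed

lemma walk_arc: "arc (walk i) (walk (Suc i))"
  using someI_ex[OF arc_ex[OF walk_V]] by (simp add: walk.simps)

declare walk.simps [simp del]

lemma walk_orbit_Suc: "walk (Suc i) \<approx> walk (Suc j) \<longleftrightarrow> walk i \<approx> walk j"
  using arc_orbit arc_orbit_back walk_arc by blast

lemma walk_orbit_add: "walk (i + d) \<approx> walk (j + d) \<longleftrightarrow> walk i \<approx> walk j"
  using walk_orbit_Suc by (induction d) auto

text \<open>
  The number of layers: the period of the walk modulo \<open>N\<close>. Since arcs are reversible modulo \<open>N\<close>,
  the walk is periodic from its first vertex on.
\<close>

definition r :: nat where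
  "r = (LEAST r. 0 < r \<and> walk 0 \<approx> walk r)"

lemma walk_orbit_diff: "i \<le> j \<Longrightarrow> walk i \<approx> walk j \<longleftrightarrow> walk 0 \<approx> walk (j - i)"
  using walk_orbit_add[of 0 i "j - i"] by simp

lemma r_pos: "0 < r" and walk_r: "walk 0 \<approx> walk r"
proof -
  have "\<not> inj walk"
  proof
    assume "inj walk"
    moreover have "range walk \<subseteq> V" using walk_V by blast
    then have "finite (range walk)" by (rule finite_subset[OF _ finite_V])
    ultimately show False using finite_imageD[of walk UNIV] infinite_UNIV_nat by simp
  qed
  then obtain i j where ij: "walk i = walk j" "i \<noteq> j" by (auto simp: inj_def)
  have "\<exists>r. 0 < r \<and> walk 0 \<approx> walk r"
  proof (cases "i < j")
    case True
    then show ?thesis using walk_orbit_diff[of i j] ij orbit_refl by (intro exI[of _ "j - i"]) auto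
  next
    case False
    then show ?thesis using walk_orbit_diff[of j i] ij orbit_refl by (intro exI[of _ "i - j"]) auto
  qed
  then have "0 < r \<and> walk 0 \<approx> walk r" unfolding r_def by (rule LeastI_ex)
  then show "0 < r" "walk 0 \<approx> walk r" by auto
qed

lemma walk_orbit_mod: "walk (i mod r) \<approx> walk i"
proof -
  have "walk i \<approx> walk (i + r * q)" for i q
  proof (induction q)
    case (Suc q)
    have "walk (i + r * q) \<approx> walk (i + r * q + r)"
      using walk_orbit_diff[of "i + r * q" "i + r * q + r"] walk_r by simp
    then show ?case using orbit_trans[OF Suc] by (simp add: algebra_simps)
  qed (simp add: orbit_refl)
  from this[of "i mod r" "i div r"] show ?thesis by simp
qed

lemma walk_orbit_iff: "walk i \<approx> walk j \<longleftrightarrow> i mod r = j mod r"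
proof
  assume "i mod r = j mod r"
  then show "walk i \<approx> walk j"
    using orbit_trans[OF orbit_sym[OF walk_orbit_mod[of i]]] walk_orbit_mod[of j] by simp
next
  have *: "\<not> walk a \<approx> walk b" if "a < b" "b < r" for a b
    using walk_orbit_diff[of a b] not_less_Least[of "b - a" "\<lambda>r. 0 < r \<and> walk 0 \<approx> walk r"] that
    by (auto simp: r_def)
  assume "walk i \<approx> walk j"
  have m: "walk (i mod r) \<approx> walk (j mod r)"
    using orbit_trans[OF orbit_trans[OF walk_orbit_mod[of i] \<open>walk i \<approx> walk j\<close>] orbit_sym[OF walk_orbit_mod[of j]]] by simp
  then show "i mod r = j mod r"
    using *[of "i mod r" "j mod r"] *[of "j mod r" "i mod r"] orbit_sym[OF m] r_pos
    by (meson mod_less_divisor nat_neq_iff)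
qed

text \<open>
  By \<open>arc_flip\<close>, mates of walk vertices traverse the layers backwards. If the mate of \<open>walk (i + d)\<close>
  were in the orbit of \<open>walk i\<close>, then the mate of \<open>walk (i + d - 1)\<close> would be in the orbit of
  \<open>walk (i + 1)\<close>. The two indices approach each other until they are equal or adjacent, and both
  possibilities have been excluded.
\<close>

lemma walk_mate_ge: "\<not> mate (walk (i + d)) \<approx> walk i"
proof (induction d arbitrary: i rule: less_induct)
  case (less d)
  consider "d = 0" | "d = 1" | e where "d = Suc (Suc e)"
    using not0_implies_Suc[of d] not0_implies_Suc[of "d - 1"] by (cases d) auto
  then show ?case
  proof cases
    case 1
    then show ?thesis using mate_other_orbit walk_V by simp
  next
    case 2
    then show ?thesis
      using cnbr_not_same_orbit[OF walk_V arc_V(3)[OF walk_arc[of i]]] by simp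
  next
    case 3
    show ?thesis
    proof
      assume *: "mate (walk (i + d)) \<approx> walk i"
      have "arc (mate (walk (i + d))) (mate (walk (Suc i + e)))"
        using arc_flip[OF walk_arc[of "Suc i + e"]] 3 by simp
      then have "mate (walk (Suc i + e)) \<approx> walk (Suc i)"
        using arc_orbit[OF _ walk_arc *] by blast
      then show False using less.IH[of e "Suc i"] 3 by simp
    qed
  qed
qed

lemma walk_mate: "\<not> mate (walk i) \<approx> walk j"
proof (cases "j \<le> i")
  case True
  then show ?thesis using walk_mate_ge[of j "i - j"] by simp
next
  case False
  then show ?thesis
    using walk_mate_ge[of i "j - i"] orbit_mate_iff[OF walk_V walk_V, of i j] orbit_sym by auto
qed

text \<open>
  The orbits that the walk visits; they become the vertices of sign \<open>Plus\<close>, and their mates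
  those of sign \<open>Minus\<close>.
\<close>

definition upper :: "'a \<Rightarrow> bool" where
  "upper v \<longleftrightarrow> (\<exists>i. v \<approx> walk i)"

lemma upperI: "v \<approx> walk i \<Longrightarrow> upper v"
  by (auto simp: upper_def)

lemma upper_in_V: "upper v \<Longrightarrow> v \<in> V"
  using orbit_in_V walk_V by (auto simp: upper_def)

lemma upper_mate: "upper v \<Longrightarrow> \<not> upper (mate v)"
proof
  assume "upper v" "upper (mate v)"
  then obtain i j where ij: "v \<approx> walk i" "mate v \<approx> walk j" by (auto simp: upper_def)
  then have "mate v \<approx> mate (walk i)" using orbit_mate orbit_in_V walk_V by blast
  then show False using walk_mate orbit_trans[OF orbit_sym] ij(2) by blast
qed

lemma arc_upper: "arc u v \<Longrightarrow> u \<approx> walk i \<Longrightarrow> v \<approx> walk (Suc i)"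
  using arc_orbit walk_arc by blast

lemma arc_upper_back: "arc u v \<Longrightarrow> v \<approx> walk (Suc i) \<Longrightarrow> u \<approx> walk i"
  using arc_orbit_back walk_arc by blast

lemma upper_or_mate:
  assumes "v \<in> V"
  shows "upper v \<or> upper (mate v)"
proof -
  have "{v \<in> V. upper v \<or> upper (mate v)} = V"
  proof (rule connected_V)
    have "walk 0 \<in> {v \<in> V. upper v \<or> upper (mate v)}" using walk_V upperI orbit_refl by blast
    then show "{v \<in> V. upper v \<or> upper (mate v)} \<noteq> {}" by blast
    fix x y assume x: "x \<in> {v \<in> V. upper v \<or> upper (mate v)}" and a: "adj x y"
    have yV: "y \<in> V" and xV: "x \<in> V" using a adj_in_V adj_in_V2 by blast+
    have "y = mate x \<or> y \<in> cnbrs x" using a nbrs_cases by (simp add: nbrs_def)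
    moreover have "upper (mate x) \<or> upper (mate (mate x))" using x mate_mate xV by auto
    moreover have "upper y \<or> upper (mate y)" if y: "y \<in> cnbrs x"
    proof (cases "upper x")
      case True
      then show ?thesis using arc_upper[OF cnbrs_arc[OF xV y]] upperI by (auto simp: upper_def)
    next
      case False
      then obtain i where "mate x \<approx> walk i" using x by (auto simp: upper_def)
      \<comment> \<open>Shift the index by the period, so that the walk has a previous vertex.\<close>
      moreover have "walk i \<approx> walk (Suc (i + r - 1))" using walk_orbit_iff r_pos by simp
      ultimately have "mate x \<approx> walk (Suc (i + r - 1))" using orbit_trans by blast
      then show ?thesis using arc_upper_back[OF cnbrs_arc[OF yV cnbrs_sym[OF xV y]]] upperI by blast
    qed
    ultimately show "y \<in> {v \<in> V. upper v \<or> upper (mate v)}" using yV by auto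
  qed auto
  then show ?thesis using assms by blast
qed

section \<open>Subgroups generated by consecutive stabilisers\<close>

text \<open>
  The common stabiliser of all vertices in layer \<open>i\<close>.
\<close>

definition layer_stab :: "nat \<Rightarrow> ('a \<Rightarrow> 'a) set" where
  "layer_stab i = stab (walk i)"

definition window :: "nat \<Rightarrow> nat \<Rightarrow> ('a \<Rightarrow> 'a) set" where
  "window i j = gen (\<Union>l<j. layer_stab (i + l))"

lemma layer_stab_eq: "i mod r = j mod r \<Longrightarrow> layer_stab i = layer_stab j"
  using walk_orbit_iff orbit_stab by (simp add: layer_stab_def)

lemma layer_stab_add_r: "layer_stab (i + r + l) = layer_stab (i + l)"
  by (rule layer_stab_eq) (metis add.commute add.left_commute mod_add_self2)

lemma stab_eq_layer_stab: "v \<approx> walk i \<Longrightarrow> stab v = layer_stab i"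
  using orbit_stab by (simp add: layer_stab_def)

lemma subgrp_layer_stab: "subgrp (layer_stab i)"
  by (simp add: layer_stab_def subgrp_stab)

lemma layer_stab_N: "n \<in> layer_stab i \<Longrightarrow> n \<in> N"
  by (simp add: layer_stab_def stab_N)

lemma subgrp_window: "subgrp (window i j)"
  unfolding window_def by (rule subgrp_gen) (use layer_stab_N in blast)

lemma window_N: "n \<in> window i j \<Longrightarrow> n \<in> N"
  using subgrp_window subgrp_subset by blast

lemma window_finite: "finite (window i j)"
  using finite_subset[OF _ N_finite] window_N by blast

lemma layer_stab_subset_window: "l < j \<Longrightarrow> layer_stab (i + l) \<subseteq> window i j"
  unfolding window_def using gen_superset[of "\<Union>l<j. layer_stab (i + l)"] by auto

lemma layer_stab_subset_window0: "0 < j \<Longrightarrow> layer_stab i \<subseteq> window i j"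
  using layer_stab_subset_window[of 0] by simp

lemma window_least: "subgrp H \<Longrightarrow> (\<And>l. l < j \<Longrightarrow> layer_stab (i + l) \<subseteq> H) \<Longrightarrow> window i j \<subseteq> H"
  unfolding window_def by (rule gen_subset_subgrp) auto

lemma window_mono: "j \<le> k \<Longrightarrow> window i j \<subseteq> window i k"
  by (rule window_least[OF subgrp_window]) (rule layer_stab_subset_window, simp)

lemma window_mono_left: "window (Suc i) j \<subseteq> window i (Suc j)"
proof (rule window_least[OF subgrp_window])
  show "layer_stab (Suc i + l) \<subseteq> window i (Suc j)" if "l < j" for l
    using layer_stab_subset_window[of "Suc l" "Suc j" i] that by simp
qed

lemma window_add_r: "window (i + r) j = window i j"
  unfolding window_def by (simp add: layer_stab_add_r)

lemma window_eq:
  assumes "i mod r = k mod r"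
  shows "window i j = window k j"
proof -
  have "layer_stab (i + l) = layer_stab (k + l)" for l by (rule layer_stab_eq) (metis assms mod_add_left_eq)
  then show ?thesis by (simp add: window_def)
qed

lemma window_one: "window i (Suc 0) = layer_stab i"
  using window_least[OF subgrp_layer_stab, of "Suc 0" i] layer_stab_subset_window0[of "Suc 0" i] by auto

text \<open>
  An element of \<open>G\<close> that takes \<open>walk 0\<close> to \<open>walk 1\<close> shifts all layers by one, because it preserves
  arcs.
\<close>

lemma card_window_Suc_le: "card (window i j) \<le> card (window (Suc i) j)"
proof -
  obtain g where g: "g \<in> G" "g (walk 0) = walk 1" using G_transitive walk_V by blast
  have shift: "g (walk i) \<approx> walk (Suc i)" for i
  proof (induction i)
    case 0
    then show ?case using g orbit_refl by simp
  next
    case (Suc i)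
    then show ?case using arc_orbit[OF arc_G[OF g(1) walk_arc] walk_arc] by blast
  qed
  show ?thesis
  proof (rule card_conj_le[OF g(1)])
    show "window (Suc i) j \<subseteq> N" using window_N by blast
    fix n assume "n \<in> window i j"
    then show "\<exists>m\<in>window (Suc i) j. g \<circ> n = m \<circ> g" unfolding window_def
    proof (induction rule: gen.induct)
      case gen_id
      show ?case by (rule bexI[OF _ gen.gen_id]) simp
    next
      case (gen_step a b)
      then obtain l where l: "l < j" "a \<in> stab (walk (i + l))" by (auto simp: layer_stab_def)
      obtain a' where a': "a' \<in> stab (g (walk (i + l)))" "g \<circ> a = a' \<circ> g"
        using stab_conj[OF g(1) l(2)] .
      have "a' \<in> layer_stab (Suc i + l)" using a'(1) stab_eq_layer_stab[OF shift] by simp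
      then have "a' \<in> (\<Union>l<j. layer_stab (Suc i + l))" using l(1) by blast
      moreover obtain b' where b': "b' \<in> gen (\<Union>l<j. layer_stab (Suc i + l))" "g \<circ> b = b' \<circ> g"
        using gen_step by blast
      ultimately have "a' \<circ> b' \<in> gen (\<Union>l<j. layer_stab (Suc i + l))" by (intro gen.gen_step)
      moreover have "g \<circ> (a \<circ> b) = (a' \<circ> b') \<circ> g" using a'(2) b'(2) by (metis comp_assoc)
      ultimately show ?case by blast
    qed
  qed
qed

text \<open>
  The orders increase weakly with \<open>i\<close> and are periodic in \<open>i\<close>, so they are constant.
\<close>

lemma card_window: "card (window i j) = card (window k j)"
proof -
  have mono: "card (window i j) \<le> card (window (i + d) j)" for i d
  proof (induction d)
    case (Suc d)
    then show ?case using card_window_Suc_le[of "i + d" j] by simp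
  qed simp
  have "card (window i j) = card (window 0 j)" for i
  proof (rule antisym)
    have "i \<le> i * r" using r_pos by simp
    then have "card (window i j) \<le> card (window (i * r) j)" using mono[of i "i * r - i"] by simp
    also have "window (i * r) j = window 0 j" by (rule window_eq) simp
    finally show "card (window i j) \<le> card (window 0 j)" .
    show "card (window 0 j) \<le> card (window i j)" using mono[of 0 i] by simp
  qed
  then show ?thesis by metis
qed

text \<open>
  Any \<open>r\<close> consecutive layers are all the layers.
\<close>

lemma all_layer_stabs_generate:
  assumes "subgrp H" "\<And>l. l < r \<Longrightarrow> layer_stab (i + l) \<subseteq> H"
  shows "H = N"
proof (rule generated[OF assms(1)])
  fix v assume v: "v \<in> V"
  have "\<exists>k. stab v = layer_stab k"
    using upper_or_mate[OF v] stab_eq_layer_stab stab_mate[OF v] unfolding upper_def by metis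
  then obtain k where k: "stab v = layer_stab k" by blast
  define k' where "k' = k + r * i"
  have "i \<le> k'" using r_pos by (simp add: k'_def trans_le_add2)
  then have "(i + (k' - i) mod r) mod r = k' mod r" by (simp add: mod_add_right_eq)
  then have "layer_stab (i + (k' - i) mod r) = layer_stab k" by (intro layer_stab_eq) (simp add: k'_def)
  then show "stab v \<subseteq> H" using assms(2)[of "(k' - i) mod r"] k r_pos by simp
qed

lemma window_r: "window i r = N"
  by (rule all_layer_stabs_generate[OF subgrp_window]) (rule layer_stab_subset_window)

text \<open>
  The length of the bit strings: \<open>s + 1\<close> is the least number of consecutive stabilisers that
  generate \<open>N\<close>.
\<close>

definition s :: nat where
  "s = (LEAST s. window 0 (Suc s) = N)"

lemma s_less_r: "s < r"
proof -
  have "window 0 (Suc (r - 1)) = N" using window_r[of 0] r_pos by simp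
  then have "s \<le> r - 1" unfolding s_def by (rule Least_le)
  then show ?thesis using r_pos by simp
qed

lemma window_full: "window i (Suc s) = N"
proof -
  have "window 0 (Suc (r - 1)) = N" using window_r[of 0] r_pos by simp
  then have "window 0 (Suc s) = N" unfolding s_def by (rule LeastI)
  then have "card (window i (Suc s)) = card N" using card_window by metis
  then show ?thesis using window_N N_finite by (intro card_subset_eq) auto
qed

lemma window_not_full:
  assumes "0 < j" "j \<le> s"
  shows "window i j \<noteq> N"
proof
  assume "window i j = N"
  then have "card (window 0 j) = card N" using card_window by metis
  then have "window 0 j = N" using window_N N_finite by (intro card_subset_eq) auto
  moreover obtain k where "j = Suc k" using assms(1) gr0_implies_Suc by blast
  ultimately show False using not_less_Least[of k "\<lambda>s. window 0 (Suc s) = N"] assms by (simp add: s_def)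
qed

lemma s_pos: "0 < s"
proof (rule ccontr)
  assume "\<not> 0 < s"
  then have "layer_stab 0 = N" using window_full[of 0] window_one by simp
  moreover obtain n where "n \<in> stab (walk 1)" "n (walk 0) \<noteq> walk 0"
    using arc_moves_in[OF walk_arc[of 0]] by auto
  ultimately show False using stab_N stab_fix by (metis layer_stab_def)
qed

text \<open>
  If adding one more stabiliser had no effect, then by the equality of orders it would have no effect
  in any position, so \<open>window i j\<close> would contain all stabilisers.
\<close>

lemma window_grow:
  assumes "0 < j" "j \<le> s"
  shows "window i (Suc j) \<noteq> window i j"
proof
  assume "window i (Suc j) = window i j"
  then have "card (window k j) = card (window k (Suc j))" for k using card_window by metis
  then have eq: "window k (Suc j) = window k j" for k
    using card_subset_eq[OF window_finite window_mono, of j "Suc j" k] by simp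
  have "layer_stab (i + l) \<subseteq> window i j" for l
  proof (induction l rule: less_induct)
    case (less l)
    show ?case
    proof (cases "l < j")
      case True
      then show ?thesis by (rule layer_stab_subset_window)
    next
      case False
      have "layer_stab (i + l) \<subseteq> window (i + (l - j)) (Suc j)"
        using layer_stab_subset_window[of j "Suc j" "i + (l - j)"] False by simp
      also have "\<dots> \<subseteq> window i j" unfolding eq
      proof (rule window_least[OF subgrp_window])
        show "layer_stab (i + (l - j) + m) \<subseteq> window i j" if "m < j" for m
          using less[of "l - j + m"] that False by (simp add: add.assoc)
      qed
      finally show ?thesis .
    qed
  qed
  then have "window i j = N" by (intro all_layer_stabs_generate subgrp_window)
  then show False using window_not_full assms by blast
qed

lemma window_grow_left:
  assumes "0 < j" "j \<le> s"
  shows "window i (Suc j) \<noteq> window (Suc i) j"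
proof
  assume "window i (Suc j) = window (Suc i) j"
  then have "card (window i j) = card (window i (Suc j))" using card_window by metis
  then have "window i j = window i (Suc j)" by (intro card_subset_eq window_finite window_mono) auto
  then show False using window_grow assms by metis
qed

lemma layer_stab_moves:
  obtains k where "k \<in> layer_stab i" "k \<notin> layer_stab (Suc i)"
  using arc_moves_out[OF walk_arc] stab_fix by (metis layer_stab_def)

lemma layer_stab_comp: "m \<in> layer_stab i \<Longrightarrow> n \<in> layer_stab i \<Longrightarrow> m \<notin> layer_stab (Suc i) \<Longrightarrow> n \<notin> layer_stab (Suc i) \<Longrightarrow> m \<circ> n \<in> layer_stab (Suc i)"
  unfolding layer_stab_def using arc_stab_comp[OF walk_arc] stabI stab_N by blast

text \<open>
  The layer stabiliser at \<open>i\<close> is covered by its subgroup fixing layer \<open>i + 1\<close>, which lies in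
  \<open>window (Suc i) j\<close>, and one further coset. So adding it to \<open>window (Suc i) j\<close> at most doubles that group.
\<close>

lemma window_coset:
  assumes k: "k \<in> layer_stab i" "k \<notin> layer_stab (Suc i)" and j: "0 < j" and e: "e \<in> window i (Suc j)"
  shows "e \<in> window (Suc i) j \<or> (\<exists>p\<in>window (Suc i) j. e = k \<circ> p)"
proof -
  let ?window = "window (Suc i) j"
  let ?H = "?window \<union> (\<circ>) k ` ?window"
  have kN: "k \<in> N" using k layer_stab_N by blast
  have KP: "layer_stab (Suc i) \<subseteq> ?window" using layer_stab_subset_window0 j by blast
  have kk: "k \<circ> k \<in> ?window" using layer_stab_comp k KP by blast
  have comp: "a \<circ> b \<in> ?window" if "a \<in> ?window" "b \<in> ?window" for a b using that subgrp_comp[OF subgrp_window] by blast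
  have k_comm: "a \<circ> k = k \<circ> a" if "a \<in> ?window" for a using N_commute kN window_N that by blast
  have "subgrp ?H" unfolding subgrp_def
  proof (intro conjI ballI)
    show "?H \<subseteq> N" using window_N N_comp kN by auto
    show "id \<in> ?H" using subgrp_id[OF subgrp_window] by blast
    fix a b assume ab: "a \<in> ?H" "b \<in> ?H"
    consider "a \<in> ?window" "b \<in> ?window" | a' where "a = k \<circ> a'" "a' \<in> ?window" "b \<in> ?window"
      | b' where "a \<in> ?window" "b = k \<circ> b'" "b' \<in> ?window"
      | a' b' where "a = k \<circ> a'" "a' \<in> ?window" "b = k \<circ> b'" "b' \<in> ?window"
      using ab by blast
    then show "a \<circ> b \<in> ?H"
    proof cases
      case 1
      then show ?thesis using comp by blast
    next
      case 2
      then have "a \<circ> b = k \<circ> (a' \<circ> b)" by (simp add: comp_assoc)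
      then show ?thesis using 2 comp by blast
    next
      case 3
      then have "a \<circ> b = k \<circ> (a \<circ> b')" using k_comm by (metis comp_assoc)
      then show ?thesis using 3 comp by blast
    next
      case 4
      then have "a \<circ> b = (k \<circ> k) \<circ> (a' \<circ> b')" using k_comm by (metis comp_assoc)
      moreover have "(k \<circ> k) \<circ> (a' \<circ> b') \<in> ?window" using comp[OF kk comp[OF 4(2,4)]] .
      ultimately show ?thesis by simp
    qed
  qed
  moreover have "layer_stab (i + l) \<subseteq> ?H" if "l < Suc j" for l
  proof (cases l)
    case 0
    show ?thesis
    proof
      fix n assume "n \<in> layer_stab (i + l)"
      then have n: "n \<in> layer_stab i" using 0 by simp
      show "n \<in> ?H"
      proof (cases "n \<in> layer_stab (Suc i)")
        case True
        then show ?thesis using KP by blast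
      next
        case False
        obtain c where c: "c \<in> N" "k \<circ> c = id" using subgrp_inverse[OF subgrp_N kN] .
        have x: "k \<circ> (c \<circ> n) = n" using c(2) by (simp flip: comp_assoc)
        have "k \<circ> k \<circ> (c \<circ> n) = k \<circ> n" using x by (simp add: comp_assoc)
        also have "\<dots> \<in> ?window" using layer_stab_comp[OF k(1) n k(2) False] KP by blast
        finally have "c \<circ> n \<in> ?window"
          by (rule subgrp_cancel[OF subgrp_window kk N_comp[OF c(1) layer_stab_N[OF n]]])
        then show ?thesis using x by (metis UnI2 imageI)
      qed
    qed
  next
    case (Suc l')
    then show ?thesis using layer_stab_subset_window[of l' j "Suc i"] that by auto
  qed
  ultimately have "window i (Suc j) \<subseteq> ?H" by (rule window_least)
  then show ?thesis using e by blast
qed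

lemma window_absorbs_left:
  assumes "k \<in> layer_stab i" "k \<notin> layer_stab (Suc i)" "0 < j" "k \<in> window (Suc i) j"
  shows "window i (Suc j) = window (Suc i) j"
proof
  show "window i (Suc j) \<subseteq> window (Suc i) j" using window_coset[OF assms(1-3)] subgrp_comp[OF subgrp_window assms(4)] by blast
qed (rule window_mono_left)

text \<open>
  Otherwise \<open>e\<close> would lie in the coset of \<open>k\<close>, and since \<open>e\<close> and the whole of \<open>window (Suc i) j\<close> lie in
  \<open>window (Suc i) (Suc j)\<close>, so would \<open>k\<close>. Then the layer stabiliser at \<open>i\<close> would add nothing to
  \<open>window (Suc i) (Suc j)\<close>, contrary to the choice of \<open>s\<close>.
\<close>

lemma window_inter:
  assumes "0 < j" "j < s" "e \<in> window i (Suc j)" "e \<in> window (Suc i) (Suc j)"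
  shows "e \<in> window (Suc i) j"
proof (rule ccontr)
  assume no: "e \<notin> window (Suc i) j"
  obtain k where k: "k \<in> layer_stab i" "k \<notin> layer_stab (Suc i)" using layer_stab_moves .
  obtain p where p: "p \<in> window (Suc i) j" "e = k \<circ> p" using window_coset[OF k assms(1,3)] no by blast
  have "p \<in> window (Suc i) (Suc j)" using p(1) window_mono[of j "Suc j"] by auto
  moreover have "p \<circ> k = e" using N_commute window_N layer_stab_N p k by blast
  ultimately have "k \<in> window (Suc i) (Suc j)" using subgrp_cancel[OF subgrp_window _ layer_stab_N[OF k(1)]] assms(4) by blast
  then have "window i (Suc (Suc j)) = window (Suc i) (Suc j)" using window_absorbs_left k by blast
  then show False using window_grow_left[of "Suc j" i] assms by simp
qed

text \<open>
  By \<open>window_inter\<close>, intersecting neighbouring windows of one length leaves windows that are shorter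
  by one; after \<open>s - 1\<close> rounds only the stabiliser of layer \<open>x\<close> remains.
\<close>

lemma window_inter_consecutive:
  assumes "s \<le> x" "\<And>l. l < s \<Longrightarrow> e \<in> window (x - l) s"
  shows "e \<in> layer_stab x"
proof -
  have "\<forall>l<s - m. e \<in> window (x - l) (s - m)" if "m < s" for m
    using that
  proof (induction m)
    case 0
    then show ?case using assms by simp
  next
    case (Suc m)
    show ?case
    proof (intro allI impI)
      fix l assume l: "l < s - Suc m"
      define j where "j = s - Suc m"
      have j: "s - m = Suc j" "0 < j" "j < s" using Suc.prems by (auto simp: j_def)
      have IH: "\<forall>l<Suc j. e \<in> window (x - l) (Suc j)" using Suc j(1) by simp
      have x: "x - l = Suc (x - Suc l)" using l assms(1) by simp
      have "e \<in> window (x - Suc l) (Suc j)" "e \<in> window (Suc (x - Suc l)) (Suc j)"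
        using IH[rule_format, of "Suc l"] IH[rule_format, of l] l x by (auto simp: j_def)
      then show "e \<in> window (x - l) (s - Suc m)" using window_inter[OF j(2,3)] x by (simp add: j_def)
    qed
  qed
  from this[of "s - 1"] show ?thesis using s_pos window_one by simp
qed

lemma index_two:
  assumes "m \<in> N" "n \<in> N"
  shows "m \<circ> n \<in> window i s \<longleftrightarrow> (m \<in> window i s \<longleftrightarrow> n \<in> window i s)"
proof -
  \<comment> \<open>Shift the index by the period, so that it has a predecessor.\<close>
  define i' where "i' = i + r - 1"
  have window: "window i s = window (Suc i') s" using window_add_r r_pos by (simp add: i'_def)
  obtain k where k: "k \<in> layer_stab i'" "k \<notin> layer_stab (Suc i')" using layer_stab_moves .
  let ?window = "window (Suc i') s"
  have kk: "k \<circ> k \<in> ?window" using layer_stab_comp[OF k(1) k(1) k(2) k(2)] layer_stab_subset_window0[OF s_pos] by blast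
  have coset: "e \<in> ?window \<or> (\<exists>p\<in>?window. e = k \<circ> p)" if "e \<in> N" for e
    using window_coset[OF k s_pos] window_full that by blast
  have "m \<circ> n \<in> ?window" if no: "m \<notin> ?window" "n \<notin> ?window"
  proof -
    obtain p where p: "p \<in> ?window" "m = k \<circ> p" using coset[OF assms(1)] no(1) by blast
    obtain q where q: "q \<in> ?window" "n = k \<circ> q" using coset[OF assms(2)] no(2) by blast
    have "m \<circ> n = k \<circ> (p \<circ> k) \<circ> q" using p q by (simp add: comp_assoc)
    also have "p \<circ> k = k \<circ> p" using N_commute[OF window_N[OF p(1)] layer_stab_N[OF k(1)]] .
    also have "k \<circ> (k \<circ> p) \<circ> q = (k \<circ> k) \<circ> (p \<circ> q)" by (simp add: comp_assoc)
    finally show ?thesis using subgrp_comp[OF subgrp_window kk subgrp_comp[OF subgrp_window p(1) q(1)]] by (simp only:)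
  qed
  moreover have "n \<in> ?window" if "m \<in> ?window" "m \<circ> n \<in> ?window"
    using subgrp_cancel[OF subgrp_window that(1) assms(2) that(2)] .
  moreover have "m \<in> ?window" if "n \<in> ?window" "m \<circ> n \<in> ?window"
    using subgrp_cancel[OF subgrp_window that(1) assms(1)] that(2) N_commute[OF assms] by simp
  moreover have "m \<circ> n \<in> ?window" if "m \<in> ?window" "n \<in> ?window" using subgrp_comp[OF subgrp_window that] .
  ultimately show ?thesis unfolding window by blast
qed

section \<open>Binary labels\<close>

text \<open>
  The group \<open>window i s\<close> has index two in \<open>N\<close> and contains the stabilisers of the layers
  \<open>i, \<dots>, i + s - 1\<close>, so it has exactly two orbits on the upper half of each of them. The label at
  layer \<open>i + j\<close> tells whether a vertex is in the orbit of \<open>walk (i + j)\<close>. The offset \<open>j\<close> is an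
  argument because the walk is only periodic modulo \<open>N\<close>: all labels of one family refer to the same
  stretch of the walk.
\<close>

definition label :: "nat \<Rightarrow> nat \<Rightarrow> 'a \<Rightarrow> bool" where
  "label i j v \<longleftrightarrow> (\<exists>a\<in>window i s. v = a (walk (i + j)))"

lemma label_walk:
  assumes "j < s" "n \<in> N"
  shows "label i j (n (walk (i + j))) \<longleftrightarrow> n \<in> window i s"
proof
  assume "label i j (n (walk (i + j)))"
  then obtain a where a: "a \<in> window i s" "n (walk (i + j)) = a (walk (i + j))" by (auto simp: label_def)
  obtain b where b: "b \<in> window i s" "b \<circ> a = id" using subgrp_inverse[OF subgrp_window a(1)] .
  have "(b \<circ> n) (walk (i + j)) = (b \<circ> a) (walk (i + j))" using a(2) by simp
  then have "b \<circ> n \<in> layer_stab (i + j)" using b N_comp[OF window_N[OF b(1)] assms(2)] stabI by (simp add: layer_stab_def)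
  then have "b \<circ> n \<in> window i s" using layer_stab_subset_window[OF assms(1)] by blast
  then show "n \<in> window i s" by (rule subgrp_cancel[OF subgrp_window b(1) assms(2)])
qed (auto simp: label_def)

lemma label_N:
  assumes "j < s" "n \<in> N" "v \<approx> walk (i + j)"
  shows "label i j (n v) \<longleftrightarrow> (label i j v \<longleftrightarrow> n \<in> window i s)"
proof -
  obtain m where m: "m \<in> N" "v = m (walk (i + j))"
    using orbit_sym[OF assms(3)] by (auto simp: same_orbit_def)
  have "label i j (n v) \<longleftrightarrow> n \<circ> m \<in> window i s"
    using label_walk[OF assms(1) N_comp[OF assms(2) m(1)]] m(2) by simp
  then show ?thesis using index_two[OF assms(2) m(1)] label_walk[OF assms(1) m(1)] m(2) by blast
qed

text \<open>
  The vertices \<open>walk (i + j)\<close> and \<open>walk (i + j + 1)\<close> are joined by an arc, and the target of an arc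
  is determined up to the stabiliser of its source, which lies in \<open>window i s\<close>.
\<close>

lemma label_arc:
  assumes "Suc j < s" "arc u v" "u \<approx> walk (i + j)"
  shows "label i (Suc j) v \<longleftrightarrow> label i j u"
proof -
  obtain n where n: "n \<in> N" "u = n (walk (i + j))"
    using orbit_sym[OF assms(3)] by (auto simp: same_orbit_def)
  have "arc u (n (walk (i + Suc j)))" using arc_N[OF n(1) walk_arc] n(2) by simp
  then obtain k where k: "k \<in> stab u" "k (n (walk (i + Suc j))) = v"
    using arc_out_orbit assms(2) by blast
  have "k \<in> layer_stab (i + j)" using k(1) stab_eq_layer_stab[OF assms(3)] by simp
  then have kP: "k \<in> window i s" using layer_stab_subset_window[of j s i] assms(1) by auto
  have "label i (Suc j) v \<longleftrightarrow> k \<circ> n \<in> window i s"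
    using label_walk[OF assms(1) N_comp[OF stab_N[OF k(1)] n(1)], of i] k(2) by simp
  also have "\<dots> \<longleftrightarrow> n \<in> window i s" using index_two[OF stab_N[OF k(1)] n(1)] kP by blast
  also have "\<dots> \<longleftrightarrow> label i j u" using label_walk[OF _ n(1), of j i] assms(1) n(2) by simp
  finally show ?thesis .
qed

text \<open>
  The element of the stabiliser of \<open>u\<close> that swaps the two targets is outside \<open>window i s\<close>; otherwise
  \<open>window i s\<close> would absorb the stabiliser of the layer before it and be all of \<open>N\<close>.
\<close>

lemma label_new:
  assumes "arc u v" "arc u v'" "v \<noteq> v'" "v \<approx> walk i"
  shows "label i 0 v' \<longleftrightarrow> \<not> label i 0 v"
proof -
  define t where "t = i + r - 1"
  have t: "Suc t mod r = i mod r" using r_pos by (simp add: t_def)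
  have "v \<approx> walk (Suc t)" using orbit_trans[OF assms(4)] walk_orbit_iff t by simp
  then have layer_stab: "stab v = layer_stab (Suc t)" "stab u = layer_stab t"
    using stab_eq_layer_stab arc_upper_back[OF assms(1)] by blast+
  obtain k where k: "k \<in> stab u" "k v = v'" using arc_out_orbit assms by blast
  have "k \<notin> window (Suc t) s"
  proof
    assume kP: "k \<in> window (Suc t) s"
    have "k \<in> layer_stab t" "k \<notin> layer_stab (Suc t)" using k assms(3) layer_stab stab_fix[of k v] by auto
    then have "window t (Suc s) = window (Suc t) s" using window_absorbs_left s_pos kP by blast
    then show False using window_grow_left s_pos by blast
  qed
  then have "k \<notin> window i s" using window_eq[OF t] by simp
  then show ?thesis using label_N[OF s_pos stab_N[OF k(1)], of v i] k(2) assms(4) by simp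
qed

definition layer :: "'a \<Rightarrow> nat" where
  "layer v = (THE i. i < r \<and> v \<approx> walk i)"

lemma layer_eq:
  assumes "v \<approx> walk i"
  shows "layer v = i mod r"
  unfolding layer_def
proof (rule the_equality)
  show "i mod r < r \<and> v \<approx> walk (i mod r)"
    using r_pos orbit_trans[OF assms orbit_sym[OF walk_orbit_mod]] by simp
  fix k assume k: "k < r \<and> v \<approx> walk k"
  then have "walk k \<approx> walk i" using orbit_trans[OF orbit_sym assms] by blast
  then show "k = i mod r" using walk_orbit_iff k by simp
qed

lemma layer_less: "upper v \<Longrightarrow> layer v < r"
  using layer_eq r_pos by (auto simp: upper_def)

lemma layer_walk:
  assumes "upper v" "i mod r = layer v"
  shows "v \<approx> walk i"
proof -
  obtain k where k: "v \<approx> walk k" using assms(1) by (auto simp: upper_def)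
  then have "walk k \<approx> walk i" using layer_eq walk_orbit_iff assms(2) by simp
  then show ?thesis using orbit_trans[OF k] by blast
qed

lemma upper_arc_target: "arc u v \<Longrightarrow> upper u \<Longrightarrow> upper v"
  using arc_upper upperI by (auto simp: upper_def)

lemma upper_arc_source:
  assumes "arc u v" "upper v"
  shows "upper u"
proof -
  have "v \<approx> walk (Suc (layer v + r - 1))" using layer_walk assms(2) layer_less[OF assms(2)] by simp
  then show ?thesis using arc_upper_back[OF assms(1)] upperI by blast
qed

lemma layer_arc:
  assumes "arc u v" "upper u"
  shows "layer v = Suc (layer u) mod r"
proof -
  have "u \<approx> walk (layer u)" using layer_walk layer_less assms(2) by simp
  then show ?thesis using layer_eq[OF arc_upper[OF assms(1)]] by blast
qed

text \<open>
  The layer at which the window starts that has layer \<open>layer v\<close> at offset \<open>j\<close>.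
\<close>

definition label_origin :: "'a \<Rightarrow> nat \<Rightarrow> nat" where
  "label_origin v j = (layer v + r - j) mod r"

text \<open>
  The oldest label comes first, so that an arc shifts the list to the left. Since \<open>s < r\<close>, the \<open>s\<close>
  windows start at different layers.
\<close>

definition labels :: "'a \<Rightarrow> bool list" where
  "labels v = map (\<lambda>m. label (label_origin v (s - Suc m)) (s - Suc m) v) [0..<s]"

lemma length_labels: "length (labels v) = s"
  by (simp add: labels_def)

lemma labels_nth: "m < s \<Longrightarrow> labels v ! m \<longleftrightarrow> label (label_origin v (s - Suc m)) (s - Suc m) v"
  by (simp add: labels_def)

lemma label_origin_walk:
  assumes "upper v" "j < s"
  shows "v \<approx> walk (label_origin v j + j)"
proof (rule layer_walk[OF assms(1)])
  have "(label_origin v j + j) mod r = (layer v + r - j + j) mod r" by (simp add: label_origin_def mod_add_left_eq)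
  then show "(label_origin v j + j) mod r = layer v" using layer_less assms s_less_r by simp
qed

lemma label_origin_arc:
  assumes "arc u v" "upper u" "Suc j < s"
  shows "label_origin v (Suc j) = label_origin u j"
proof (cases "Suc (layer u) < r")
  case True
  then show ?thesis using layer_arc[OF assms(1,2)] by (simp add: label_origin_def)
next
  case False
  then have "Suc (layer u) = r" using layer_less[OF assms(2)] by simp
  then have "layer u = r - 1" "layer v = 0" using layer_arc[OF assms(1,2)] by auto
  moreover have "r - 1 + r - j = (r - Suc j) + r" using assms(3) s_less_r by simp
  ultimately show ?thesis unfolding label_origin_def by (metis add_0 mod_add_self2)
qed

lemma labels_arc:
  assumes "arc u v" "upper u" "Suc m < s"
  shows "labels v ! m = labels u ! Suc m"
proof -
  define j where "j = s - Suc (Suc m)"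
  have j: "Suc j < s" "s - Suc m = Suc j" using assms(3) by (auto simp: j_def)
  have "labels u ! Suc m \<longleftrightarrow> label (label_origin u j) j u" using labels_nth assms(3) by (simp add: j_def)
  also have "\<dots> \<longleftrightarrow> label (label_origin u j) (Suc j) v"
    using label_arc[OF j(1) assms(1) label_origin_walk[OF assms(2)]] j(1) by simp
  also have "\<dots> \<longleftrightarrow> labels v ! m"
    using labels_nth[of m v] assms(3) j label_origin_arc[OF assms(1,2) j(1)] by simp
  finally show ?thesis by simp
qed

lemma labels_arc_shift:
  assumes "arc u v" "upper u"
  shows "tl (labels u) = butlast (labels v)"
proof (rule nth_equalityI)
  show "tl (labels u) ! m = butlast (labels v) ! m" if "m < length (tl (labels u))" for m
    using that labels_arc[OF assms, of m] by (simp add: nth_tl nth_butlast length_labels)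
qed (simp add: length_labels)

lemma labels_last_new:
  assumes "arc u v" "arc u v'" "upper u" "v \<noteq> v'"
  shows "labels v' ! (s - 1) \<longleftrightarrow> \<not> labels v ! (s - 1)"
proof -
  have v: "upper v" using upper_arc_target assms by blast
  have st: "label_origin v' 0 = label_origin v 0" using layer_arc assms by (simp add: label_origin_def)
  have "labels w ! (s - 1) \<longleftrightarrow> label (label_origin w 0) 0 w" for w using labels_nth[of "s - 1" w] s_pos by simp
  then show ?thesis using label_new[OF assms(1,2,4)] label_origin_walk[OF v s_pos] st by simp
qed

text \<open>
  An element of \<open>N\<close> that takes \<open>u\<close> to \<open>v\<close> lies in every window through their layer, hence in the
  stabiliser of that layer.
\<close>

lemma labels_inj:
  assumes "upper u" "upper v" "layer u = layer v" "labels u = labels v"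
  shows "u = v"
proof -
  define x where "x = layer u + r"
  have u: "u \<approx> walk x" and v: "v \<approx> walk x"
    using layer_walk layer_less assms by (simp_all add: x_def)
  obtain e where e: "e \<in> N" "v = e u"
    using orbit_trans[OF u orbit_sym[OF v]] by (auto simp: same_orbit_def)
  have "e \<in> layer_stab x"
  proof (rule window_inter_consecutive)
    show "s \<le> x" using s_less_r by (simp add: x_def)
    fix l assume l: "l < s"
    have "labels u ! (s - Suc l) \<longleftrightarrow> label (label_origin u l) l u" "labels v ! (s - Suc l) \<longleftrightarrow> label (label_origin v l) l v"
      using labels_nth[of "s - Suc l"] l by auto
    moreover have "label_origin v l = label_origin u l" using assms by (simp add: label_origin_def)
    ultimately have "label (label_origin u l) l (e u) \<longleftrightarrow> label (label_origin u l) l u" using assms e(2) by simp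
    then have "e \<in> window (label_origin u l) s" using label_N[OF l e(1) label_origin_walk[OF assms(1) l]] by blast
    then show "e \<in> window (x - l) s" using window_eq[of "label_origin u l" "x - l"] by (simp add: label_origin_def x_def)
  qed
  then have "e \<in> stab u" using stab_eq_layer_stab[OF u] by simp
  then show ?thesis using stab_fix e(2) by metis
qed

text \<open>
  The last \<open>m\<close> labels of a vertex were chosen freely, one at a time, in the last \<open>m\<close> steps of a walk
  that ends there.
\<close>

lemma labels_surj:
  assumes "length n = s" "x < r"
  shows "\<exists>v. upper v \<and> layer v = x \<and> labels v = n"
proof -
  have "\<exists>v. v \<approx> walk i \<and> (\<forall>t. s - m \<le> t \<and> t < s \<longrightarrow> labels v ! t = f t)" if "m \<le> s"
    for m i and f :: "nat \<Rightarrow> bool"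
    using that
  proof (induction m arbitrary: i f)
    case 0
    show ?case using orbit_refl by (intro exI[of _ "walk i"]) auto
  next
    case (Suc m)
    define k where "k = i + r - 1"
    obtain u where u: "u \<approx> walk k" "\<forall>t. s - m \<le> t \<and> t < s \<longrightarrow> labels u ! t = f (t - 1)"
      using Suc.IH[of k "\<lambda>t. f (t - 1)"] Suc.prems by auto
    have pu: "upper u" using u(1) by (rule upperI)
    obtain v0 where v0: "arc u v0" using arc_ex upper_in_V[OF pu] by blast
    obtain n where n: "n \<in> stab u" "n v0 \<noteq> v0" using arc_moves_out[OF v0] .
    have v1: "arc u (n v0)" using arc_N[OF stab_N[OF n(1)] v0] stab_fix[OF n(1)] by simp
    obtain v where v: "arc u v" "labels v ! (s - 1) = f (s - 1)"
      using labels_last_new[OF v0 v1 pu] n(2) v0 v1 by (metis (full_types))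
    have "v \<approx> walk (Suc k)" using arc_upper[OF v(1) u(1)] .
    moreover have "walk (Suc k) \<approx> walk i" using walk_orbit_iff r_pos by (simp add: k_def)
    ultimately have "v \<approx> walk i" by (rule orbit_trans)
    moreover have "labels v ! t = f t" if t: "s - Suc m \<le> t" "t < s" for t
    proof (cases "Suc t < s")
      case True
      have "s - m \<le> Suc t" using t by simp
      then show ?thesis using labels_arc[OF v(1) pu True] u(2) True by simp
    next
      case False
      then have "t = s - 1" using t by simp
      then show ?thesis using v(2) by simp
    qed
    ultimately show ?case by blast
  qed
  from this[of s x "\<lambda>t. n ! t"] obtain v where v: "v \<approx> walk x" "\<forall>t<s. labels v ! t = n ! t" by auto
  have "labels v = n" using v(2) assms(1) by (intro nth_equalityI) (auto simp: length_labels)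
  then show ?thesis using v(1) upperI layer_eq[OF v(1)] assms(2) by auto
qed

text \<open>
  An upper vertex with the labels of \<open>mate v\<close> and in its layer is \<open>mate v\<close> itself. So it suffices that one of
  the two arcs out of \<open>u\<close> ends in a vertex whose last label agrees with that of \<open>mate v\<close>.
\<close>

lemma adj_upper_mate:
  assumes "upper u" "v \<in> V" "\<not> upper v"
  shows "adj u v \<longleftrightarrow> mate v = u \<or>
    layer (mate v) = Suc (layer u) mod r \<and> tl (labels u) = butlast (labels (mate v))"
proof -
  have uV: "u \<in> V" using assms upper_in_V by blast
  have mv: "upper (mate v)" using upper_or_mate assms by blast
  have "adj u v \<longleftrightarrow> v = mate u \<or> v \<in> cnbrs u"
    using nbrs_cases[of v u] mate_in_nbrs[OF uV] cnbrs_nbrs by (auto simp: nbrs_def)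
  moreover have "v = mate u \<longleftrightarrow> mate v = u" using mate_mate uV assms(2) by metis
  moreover have "v \<in> cnbrs u \<longleftrightarrow> arc u (mate v)"
    using uV assms(2) mate_in_V mate_mate by (simp add: arc_def)
  moreover have "arc u w \<longleftrightarrow> layer w = Suc (layer u) mod r \<and> tl (labels u) = butlast (labels w)"
    if w: "upper w" for w
  proof
    assume "arc u w"
    then show "layer w = Suc (layer u) mod r \<and> tl (labels u) = butlast (labels w)"
      using layer_arc labels_arc_shift assms(1) by blast
  next
    assume R: "layer w = Suc (layer u) mod r \<and> tl (labels u) = butlast (labels w)"
    obtain v0 where v0: "arc u v0" using arc_ex uV by blast
    obtain n where n: "n \<in> stab u" "n v0 \<noteq> v0" using arc_moves_out[OF v0] .
    have v1: "arc u (n v0)" using arc_N[OF stab_N[OF n(1)] v0] stab_fix[OF n(1)] by simp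
    obtain w' where w': "arc u w'" "labels w' ! (s - 1) = labels w ! (s - 1)"
      using labels_last_new[OF v0 v1 assms(1)] n(2) v0 v1 by (metis (full_types))
    have ne: "labels y \<noteq> []" for y using s_pos length_labels[of y] by auto
    have lst: "last (labels y) = labels y ! (s - 1)" for y
      using last_conv_nth[OF ne, of y] length_labels by simp
    have "butlast (labels w') = butlast (labels w)" using labels_arc_shift[OF w'(1) assms(1)] R by simp
    moreover have "last (labels w') = last (labels w)" using lst[of w] lst[of w'] w'(2) by simp
    ultimately have "labels w' = labels w"
      using append_butlast_last_id[OF ne[of w]] append_butlast_last_id[OF ne[of w']] by simp
    then have "w' = w"
      using labels_inj upper_arc_target[OF w'(1) assms(1)] w layer_arc[OF w'(1) assms(1)] R by simp
    then show "arc u w" using w'(1) by simp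
  qed
  ultimately show ?thesis using mv by blast
qed

lemma adj_same_sign:
  assumes "u \<in> V" "v \<in> V" "upper u \<longleftrightarrow> upper v"
  shows "\<not> adj u v"
proof
  assume "adj u v"
  then have "v = mate u \<or> v \<in> cnbrs u" using nbrs_cases by (simp add: nbrs_def)
  then show False
  proof
    assume "v = mate u"
    then show False using assms upper_mate upper_or_mate mate_mate by metis
  next
    assume "v \<in> cnbrs u"
    then have a: "arc u (mate v)" by (rule cnbrs_arc[OF assms(1)])
    show False
      using upper_arc_target[OF a] upper_arc_source[OF a] assms upper_mate upper_or_mate by blast
  qed
qed

end

section \<open>The split Praeger-Xu graphs\<close>

lemma graph_isoI:
  assumes "pair_wf_digraph \<Gamma>" "parcs \<Delta> \<subseteq> pverts \<Delta> \<times> pverts \<Delta>"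
    and f: "bij_betw f (pverts \<Gamma>) (pverts \<Delta>)"
    and arcs: "\<And>u v. u \<in> pverts \<Gamma> \<Longrightarrow> v \<in> pverts \<Gamma> \<Longrightarrow> (f u, f v) \<in> parcs \<Delta> \<longleftrightarrow> (u, v) \<in> parcs \<Gamma>"
  shows "graph_iso \<Gamma> \<Delta>"
proof -
  interpret pair_wf_digraph \<Gamma> by (rule assms(1))
  define h where "h = \<lparr>iso_verts = f, iso_arcs = map_prod f f, iso_head = snd, iso_tail = fst\<rparr>"
  have arcs_in: "parcs \<Gamma> \<subseteq> pverts \<Gamma> \<times> pverts \<Gamma>" using wellformed' by auto
  have inj: "inj_on f (pverts \<Gamma>)" and im: "f ` pverts \<Gamma> = pverts \<Delta>" using f by (auto simp: bij_betw_def)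
  have "inj_on (map_prod f f) (parcs \<Gamma>)"
    by (rule inj_on_subset[OF map_prod_inj_on[OF inj inj] arcs_in])
  then have "pre_digraph.digraph_isomorphism (with_proj \<Gamma>) h"
    using inj wf_digraph by (auto simp: pre_digraph.digraph_isomorphism_def h_def)
  moreover have "map_prod f f ` parcs \<Gamma> = parcs \<Delta>"
  proof (intro equalityI subsetI)
    fix e assume "e \<in> map_prod f f ` parcs \<Gamma>"
    then show "e \<in> parcs \<Delta>" using arcs arcs_in by auto
  next
    fix e assume e: "e \<in> parcs \<Delta>"
    then have "fst e \<in> f ` pverts \<Gamma>" "snd e \<in> f ` pverts \<Gamma>" using assms(2) im by auto
    then obtain u v where uv: "u \<in> pverts \<Gamma>" "v \<in> pverts \<Gamma>" "fst e = f u" "snd e = f v" by auto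
    then have "(u, v) \<in> parcs \<Gamma>" using arcs e by (metis prod.collapse)
    then show "e \<in> map_prod f f ` parcs \<Gamma>"
      using uv by (intro image_eqI[of _ _ "(u, v)"]) (auto simp: prod_eq_iff)
  qed
  then have "with_proj \<Delta> = app_iso h (with_proj \<Gamma>)"
    using im by (simp add: app_iso_def h_def with_proj_def)
  ultimately show ?thesis by (auto simp: graph_iso_def digraph_iso_def)
qed

lemma graph_of_edges_simps:
  "pverts (graph_of_edges V E) = V"
  "(u, v) \<in> parcs (graph_of_edges V E) \<longleftrightarrow> u \<in> V \<and> v \<in> V \<and> {u, v} \<in> E"
  "parcs (graph_of_edges V E) \<subseteq> V \<times> V"
  by (auto simp: graph_of_edges_def)

lemma SPX_edge_plus_minus:
  assumes "1 \<le> s" "length m = s" "length n = s" "x < r"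
  shows "{(m, x, Plus), (n, y, Minus)} \<in> SPX_edges r s \<longleftrightarrow>
    m = n \<and> x = y \<or> y = (x + 1) mod r \<and> tl m = butlast n"
proof -
  have "(\<exists>l. length l = s + 1 \<and> butlast l = m \<and> tl l = n) \<longleftrightarrow> tl m = butlast n"
  proof
    assume "\<exists>l. length l = s + 1 \<and> butlast l = m \<and> tl l = n"
    then show "tl m = butlast n" by (auto simp: butlast_tl)
  next
    assume *: "tl m = butlast n"
    have "m \<noteq> []" "n \<noteq> []" using assms by auto
    then have "butlast (hd m # n) = m" using * by (simp flip: *)
    then show "\<exists>l. length l = s + 1 \<and> butlast l = m \<and> tl l = n"
      using assms by (intro exI[of _ "hd m # n"]) simp
  qed
  moreover have "{(m, x, Plus), (n, y, Minus)} \<in> SPX_edges r s \<longleftrightarrow>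
      (\<exists>l. length l = s + 1 \<and> butlast l = m \<and> tl l = n) \<and> y = (x + 1) mod r \<or> m = n \<and> x = y"
    using assms(2,4) by (simp add: SPX_edges_def doubleton_eq_iff) blast
  ultimately show ?thesis by blast
qed

lemma SPX_edge_same_sign: "{(m, x, a), (n, y, a)} \<notin> SPX_edges r s"
  by (auto simp: SPX_edges_def doubleton_eq_iff)

lemma SPX_verts_2_1:
  "SPX_verts 2 1 = {([a], x, sg) | a x sg. x < 2}"
  by (auto simp: SPX_verts_def length_Suc_conv)

text \<open>
  \<open>S(PX(2,2,1))\<close> consists of two 4-cycles, told apart by the last bit, and a perfect matching between
  them. The first two bits are the position on the 4-cycle. The summand \<open>of_nat x\<close> in the second bit
  makes partners in the matching take the same position on their cycles.
\<close>

definition cube_code :: "bit list \<times> nat \<times> sign \<Rightarrow> bit list" where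
  "cube_code = (\<lambda>(n, x, sg). [hd n, hd n + of_nat x, of_nat x + of_bool (sg = Minus)])"

lemma bit_cases: "(b::bit) = 0 \<or> b = 1"
  by (cases b) auto

lemma cube_code_bij: "bij_betw cube_code (SPX_verts 2 1) {u. length u = 3}"
proof (rule bij_betw_imageI)
  show "inj_on cube_code (SPX_verts 2 1)"
  proof (rule inj_onI)
    fix u v assume "u \<in> SPX_verts 2 1" "v \<in> SPX_verts 2 1" and eq: "cube_code u = cube_code v"
    then obtain a x sg b y sg' where *: "u = ([a], x, sg)" "v = ([b], y, sg')" "x < 2" "y < 2"
      unfolding SPX_verts_2_1 by blast
    then have "x = 0 \<or> x = 1" "y = 0 \<or> y = 1" by auto
    then show "u = v" using * eq bit_cases[of a] bit_cases[of b] by (cases sg; cases sg') (auto simp: cube_code_def)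
  qed
  show "cube_code ` SPX_verts 2 1 = {u. length u = 3}"
  proof
    show "cube_code ` SPX_verts 2 1 \<subseteq> {u. length u = 3}" by (auto simp: cube_code_def)
    show "{u. length u = 3} \<subseteq> cube_code ` SPX_verts 2 1"
    proof
      fix u :: "bit list" assume "u \<in> {u. length u = 3}"
      then obtain p q t where u: "u = [p, q, t]" by (auto simp: numeral_3_eq_3 length_Suc_conv)
      define x :: nat where "x = of_bool (p \<noteq> q)"
      have "u = cube_code ([p], x, if t = of_nat x then Plus else Minus)"
        using bit_cases[of p] bit_cases[of q] bit_cases[of t] by (auto simp: u cube_code_def x_def)
      moreover have "x < 2" by (simp add: x_def)
      ultimately show "u \<in> cube_code ` SPX_verts 2 1" unfolding SPX_verts_2_1 by blast
    qed
  qed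
qed

lemma symmetric_edge_iff:
  assumes "\<And>u v. Q u v \<Longrightarrow> Q v u"
  shows "{u, v} \<in> {{u, v} | u v. Q u v} \<longleftrightarrow> Q u v"
  using assms by (auto simp: doubleton_eq_iff)

lemma cube_edge_iff:
  "(u, v) \<in> parcs (cube_graph 3) \<longleftrightarrow> length u = 3 \<and> length v = 3 \<and> card {i. i < 3 \<and> u ! i \<noteq> v ! i} = 1"
proof -
  define Q where "Q u v \<longleftrightarrow> length u = 3 \<and> length v = 3 \<and> card {i. i < 3 \<and> u ! i \<noteq> v ! i} = 1"
    for u v :: "bit list"
  have "Q v u" if "Q u v" for u v using that unfolding Q_def by (simp add: eq_commute)
  then have "{u, v} \<in> {{u, v} | u v. Q u v} \<longleftrightarrow> Q u v" by (rule symmetric_edge_iff)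
  then show ?thesis unfolding cube_graph_def graph_of_edges_simps Q_def by blast
qed

lemma card_differences_3:
  "card {i. i < 3 \<and> [a, b, c] ! i \<noteq> [a', b', c'] ! i} =
    of_bool (a \<noteq> a') + of_bool (b \<noteq> b') + of_bool (c \<noteq> c')"
proof -
  have "{i. i < 3 \<and> [a, b, c] ! i \<noteq> [a', b', c'] ! i} =
      (if a \<noteq> a' then {0} else {}) \<union> (if b \<noteq> b' then {1} else {}) \<union> (if c \<noteq> c' then {2} else {})"
    by (auto simp: less_Suc_eq numeral_3_eq_3 numeral_2_eq_2 split: if_splits)
  then show ?thesis by simp
qed

lemma cube_code_edge:
  assumes "u \<in> SPX_verts 2 1" "v \<in> SPX_verts 2 1"
  shows "(cube_code u, cube_code v) \<in> parcs (cube_graph 3) \<longleftrightarrow> {u, v} \<in> SPX_edges 2 1"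
proof -
  have PM: "(cube_code ([a], x, Plus), cube_code ([b], y, Minus)) \<in> parcs (cube_graph 3) \<longleftrightarrow>
      {([a], x, Plus), ([b], y, Minus)} \<in> SPX_edges 2 1" if "x < 2" "y < 2" for a b x y
  proof -
    have "x = 0 \<or> x = 1" "y = 0 \<or> y = 1" using that by auto
    then show ?thesis
      using that bit_cases[of a] bit_cases[of b] SPX_edge_plus_minus[of 1 "[a]" "[b]" x 2 y]
      by (auto simp: cube_edge_iff cube_code_def card_differences_3)
  qed
  have same: "(cube_code ([a], x, sg), cube_code ([b], y, sg)) \<notin> parcs (cube_graph 3)"
    if "x < 2" "y < 2" for a b x y sg
  proof -
    have "x = 0 \<or> x = 1" "y = 0 \<or> y = 1" using that by auto
    then show ?thesis
      using bit_cases[of a] bit_cases[of b]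
      by (cases sg) (auto simp: cube_edge_iff cube_code_def card_differences_3)
  qed
  have sym: "(p, q) \<in> parcs (cube_graph 3) \<longleftrightarrow> (q, p) \<in> parcs (cube_graph 3)" for p q
    by (auto simp: cube_graph_def graph_of_edges_simps insert_commute)
  obtain a x sg b y sg' where *: "u = ([a], x, sg)" "v = ([b], y, sg')" "x < 2" "y < 2"
    using assms unfolding SPX_verts_2_1 by blast
  show ?thesis
  proof (cases "sg = sg'")
    case True
    then show ?thesis using same SPX_edge_same_sign * by simp
  next
    case False
    then consider "sg = Plus" "sg' = Minus" | "sg = Minus" "sg' = Plus"
      by (cases sg; cases sg') auto
    then show ?thesis
    proof cases
      case 1
      then show ?thesis using PM * by simp
    next
      case 2
      then show ?thesis using PM[of y x b a] * sym by (simp add: insert_commute)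
    qed
  qed
qed

context cubic_action_ladder
begin

text \<open>
  A lower vertex takes the labels and the layer of its mate.
\<close>

lemma SPX_iso:
  obtains \<phi> where "bij_betw \<phi> V (SPX_verts r s)"
    "\<And>u v. u \<in> V \<Longrightarrow> v \<in> V \<Longrightarrow> {\<phi> u, \<phi> v} \<in> SPX_edges r s \<longleftrightarrow> adj u v"
proof -
  define base where "base v = (if upper v then v else mate v)" for v
  define code where "code v = (map of_bool (labels v) :: bit list)" for v
  define \<phi> where "\<phi> v = (code (base v), layer (base v), if upper v then Plus else Minus)" for v
  have base: "upper (base v)" if "v \<in> V" for v using upper_or_mate[OF that] by (auto simp: base_def)
  have code_inj: "code u = code v \<longleftrightarrow> labels u = labels v" for u v
    by (auto simp: code_def intro!: inj_onI dest!: map_injective)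
  have code_len: "length (code v) = s" for v by (simp add: code_def length_labels)
  have code_shift: "tl (code u) = butlast (code v) \<longleftrightarrow> tl (labels u) = butlast (labels v)" for u v
    unfolding code_def map_tl[symmetric] map_butlast[symmetric]
    by (auto intro!: inj_onI dest!: map_injective)
  have inj: "inj_on \<phi> V"
  proof (rule inj_onI)
    fix u v assume uv: "u \<in> V" "v \<in> V" "\<phi> u = \<phi> v"
    then have "base u = base v" using labels_inj[OF base base] by (auto simp: \<phi>_def code_inj)
    moreover have "upper u \<longleftrightarrow> upper v" using uv(3) by (auto simp: \<phi>_def split: if_splits)
    ultimately show "u = v" using mate_inj uv by (auto simp: base_def split: if_splits)
  qed
  have "\<phi> ` V = SPX_verts r s"
  proof
    show "\<phi> ` V \<subseteq> SPX_verts r s" using base layer_less code_len by (auto simp: \<phi>_def SPX_verts_def)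
    show "SPX_verts r s \<subseteq> \<phi> ` V"
    proof
      fix z assume "z \<in> SPX_verts r s"
      then obtain n x sg where z: "z = (n, x, sg)" "length n = s" "x < r" by (auto simp: SPX_verts_def)
      obtain v where v: "upper v" "layer v = x" "labels v = map (\<lambda>b. b = 1) n"
        using labels_surj[of "map (\<lambda>b. b = 1) n" x] z by auto
      have "(of_bool (b = 1) :: bit) = b" for b using bit_cases[of b] by auto
      then have c: "code v = n" using v(3) by (simp add: code_def comp_def)
      have "\<phi> v = (n, x, Plus)" using v c by (simp add: \<phi>_def base_def)
      moreover have "\<phi> (mate v) = (n, x, Minus)"
        using v c upper_mate[OF v(1)] mate_mate[OF upper_in_V[OF v(1)]] by (simp add: \<phi>_def base_def)
      ultimately show "z \<in> \<phi> ` V"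
        using upper_in_V[OF v(1)] mate_in_V z(1) by (cases sg) (metis imageI)+
    qed
  qed
  then have "bij_betw \<phi> V (SPX_verts r s)" using inj by (simp add: bij_betw_def)
  moreover have edge: "{\<phi> u, \<phi> v} \<in> SPX_edges r s \<longleftrightarrow> adj u v"
    if uv: "u \<in> V" "v \<in> V" "upper u" "\<not> upper v" for u v
  proof -
    have mv: "upper (mate v)" using upper_or_mate uv by blast
    have "code u = code (mate v) \<and> layer u = layer (mate v) \<longleftrightarrow> mate v = u"
      using labels_inj[OF uv(3) mv] code_inj by auto
    then show ?thesis
      using SPX_edge_plus_minus[of s "code u" "code (mate v)" "layer u" r "layer (mate v)"]
        adj_upper_mate[OF uv(3,2,4)] s_pos code_len layer_less[OF uv(3)] uv
      by (auto simp: \<phi>_def base_def code_shift)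
  qed
  moreover have "{\<phi> u, \<phi> v} \<in> SPX_edges r s \<longleftrightarrow> adj u v" if uv: "u \<in> V" "v \<in> V" for u v
  proof -
    consider "upper u" "\<not> upper v" | "upper v" "\<not> upper u" | "upper u \<longleftrightarrow> upper v" by blast
    then show ?thesis
    proof cases
      case 1
      then show ?thesis using edge uv by blast
    next
      case 2
      then show ?thesis using edge[of v u] uv adj_sym by (metis insert_commute)
    next
      case 3
      then have "adj u v = False" using adj_same_sign uv by blast
      then show ?thesis using 3 SPX_edge_same_sign by (simp add: \<phi>_def)
    qed
  qed
  ultimately show thesis using that by blast
qed

end

section \<open>The classification\<close>

context cubic_action
begin

text \<open>
  The conjugate of a stabiliser by an element of \<open>G\<close> is again a stabiliser.
\<close>

lemma gen_stabs_normal: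
  assumes "g \<in> G" "n \<in> gen (\<Union>v\<in>V. stab v)"
  shows "\<exists>m\<in>gen (\<Union>v\<in>V. stab v). g \<circ> n = m \<circ> g"
  using assms(2)
proof (induction rule: gen.induct)
  case gen_id
  show ?case by (rule bexI[OF _ gen.gen_id]) simp
next
  case (gen_step a b)
  then obtain v where v: "v \<in> V" "a \<in> stab v" by blast
  obtain a' where a': "a' \<in> stab (g v)" "g \<circ> a = a' \<circ> g" using stab_conj[OF assms(1) v(2)] .
  obtain b' where b': "b' \<in> gen (\<Union>v\<in>V. stab v)" "g \<circ> b = b' \<circ> g" using gen_step by blast
  have "g v \<in> V" using G_in_V[OF assms(1)] v(1) by blast
  then have "a' \<circ> b' \<in> gen (\<Union>v\<in>V. stab v)" using a'(1) b'(1) by (intro gen.gen_step) auto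
  moreover have "g \<circ> (a \<circ> b) = (a' \<circ> b') \<circ> g" using a'(2) b'(2) by (metis comp_assoc)
  ultimately show ?case by blast
qed

lemma cubic_action_gen_stabs: "cubic_action V adj G (gen (\<Union>v\<in>V. stab v))"
proof -
  let ?E = "gen (\<Union>v\<in>V. stab v)"
  have EN: "?E \<subseteq> N" using gen_subset_subgrp[OF subgrp_N] stab_N by blast
  have fixing: "\<exists>v\<in>V. \<exists>n\<in>?E. n v = v \<and> n \<noteq> id"
  proof -
    obtain v n where "v \<in> V" "n \<in> N" "n v = v" "n \<noteq> id" using N_not_semiregular by blast
    moreover from this have "n \<in> ?E" using gen_superset stabI by blast
    ultimately show ?thesis by blast
  qed
  show ?thesis
  proof unfold_locales
    show "X = V" if "X \<subseteq> V" "X \<noteq> {}" "\<And>x y. x \<in> X \<Longrightarrow> adj x y \<Longrightarrow> y \<in> X" for X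
      using connected_V that by blast
    show "?E \<subseteq> G" using EN N_subset_G by blast
    show "m \<circ> n = n \<circ> m" if "m \<in> ?E" "n \<in> ?E" for m n using N_commute EN that by blast
  qed (rule finite_V adj_irrefl gen.gen_id fixing
      | (rule adj_in_V adj_sym degree_3 G_permutes G_adj G_transitive gen_stabs_normal gen_comp;
          assumption))+
qed

text \<open>
  Passing from \<open>N\<close> to the subgroup generated by its vertex stabilisers does not change the vertex
  stabilisers, so the case distinction on them can be made before.
\<close>

theorem cubic_action_classification:
  "(\<exists>A B. V = A \<union> B \<and> A \<inter> B = {} \<and> card A = 3 \<and> card B = 3 \<and>
      (\<forall>x y. adj x y \<longleftrightarrow> x \<in> A \<and> y \<in> B \<or> x \<in> B \<and> y \<in> A)) \<or>
    card V = 4 \<and> (\<forall>x\<in>V. \<forall>y\<in>V. adj x y \<longleftrightarrow> x \<noteq> y) \<or>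
    (\<exists>r s \<phi>. 1 \<le> s \<and> s < r \<and> bij_betw \<phi> V (SPX_verts r s) \<and>
      (\<forall>u\<in>V. \<forall>v\<in>V. {\<phi> u, \<phi> v} \<in> SPX_edges r s \<longleftrightarrow> adj u v))"
proof (cases "\<exists>v\<in>V. \<forall>w\<in>nbrs v. \<exists>n\<in>stab v. n w \<noteq> w")
  case True
  then obtain v where v: "v \<in> V" "\<forall>w\<in>nbrs v. \<exists>n\<in>stab v. n w \<noteq> w" by blast
  obtain A B where "V = A \<union> B" "A \<inter> B = {}" "card A = 3" "card B = 3"
    "\<And>x y. adj x y \<longleftrightarrow> x \<in> A \<and> y \<in> B \<or> x \<in> B \<and> y \<in> A"
    by (rule K33_if_no_fixed_nbr[OF v], rule that) auto
  then show ?thesis by (intro disjI1 exI[of _ A] exI[of _ B]) simp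
next
  case False
  define E where "E = gen (\<Union>v\<in>V. stab v)"
  interpret E: cubic_action V adj G E unfolding E_def by (rule cubic_action_gen_stabs)
  have stab_E: "E.stab v = stab v" if "v \<in> V" for v
  proof
    have "E \<subseteq> N" unfolding E_def using gen_subset_subgrp[OF subgrp_N] stab_N by blast
    then show "E.stab v \<subseteq> stab v" by (auto simp: E.stab_def stab_def)
    have "stab v \<subseteq> E" using gen_superset[of "\<Union>v\<in>V. stab v"] that by (auto simp: E_def)
    then show "stab v \<subseteq> E.stab v" by (auto simp: E.stab_def stab_def)
  qed
  interpret E: cubic_action_matched V adj G E
  proof unfold_locales
    show "\<exists>w\<in>E.nbrs v. \<forall>n\<in>E.stab v. n w = w" if "v \<in> V" for v
      using False that stab_E by blast
    show "H = E" if H: "E.subgrp H" "\<And>v. v \<in> V \<Longrightarrow> E.stab v \<subseteq> H" for H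
    proof
      show "H \<subseteq> E" using H(1) by (simp add: E.subgrp_def)
      have "stab v \<subseteq> H" if "v \<in> V" for v using H(2)[OF that] stab_E[OF that] by simp
      then show "E \<subseteq> H" unfolding E_def by (intro E.gen_subset_subgrp[OF H(1)] UN_least)
    qed
  qed
  show ?thesis
  proof (cases "\<exists>v\<in>V. E.same_orbit (E.mate v) v")
    case True
    then show ?thesis using E.K4_if_mate_in_orbit by blast
  next
    case False
    then interpret E: cubic_action_ladder V adj G E by unfold_locales blast
    obtain \<phi> where "bij_betw \<phi> V (SPX_verts E.r E.s)"
      "\<And>u v. u \<in> V \<Longrightarrow> v \<in> V \<Longrightarrow> {\<phi> u, \<phi> v} \<in> SPX_edges E.r E.s \<longleftrightarrow> adj u v"
      using E.SPX_iso by blast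
    moreover have "1 \<le> E.s" "E.s < E.r" using E.s_pos E.s_less_r by auto
    ultimately show ?thesis by blast
  qed
qed

end

section \<open>Automorphism groups as groups of permutations\<close>

text \<open>
  Elements of \<^const>\<open>Bij\<close> are undefined outside the set; making them the identity there turns
  \<^const>\<open>compose\<close> into \<open>(\<circ>)\<close>.
\<close>

definition perm_ext :: "'a set \<Rightarrow> ('a \<Rightarrow> 'a) \<Rightarrow> 'a \<Rightarrow> 'a" where
  "perm_ext V f = (\<lambda>v. if v \<in> V then f v else v)"

lemma perm_ext_apply: "v \<in> V \<Longrightarrow> perm_ext V f v = f v"
  by (simp add: perm_ext_def)

lemma perm_ext_permutes:
  assumes "f \<in> Bij V"
  shows "perm_ext V f permutes V"
proof (rule bij_imp_permutes)
  have "bij_betw f V V" using assms by (simp add: Bij_def)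
  then show "bij_betw (perm_ext V f) V V"
    by (rule bij_betw_cong[THEN iffD1, rotated]) (simp add: perm_ext_apply)
qed (simp add: perm_ext_def)

lemma perm_ext_compose:
  assumes "f \<in> Bij V"
  shows "perm_ext V (compose V g f) = perm_ext V g \<circ> perm_ext V f"
proof
  fix v
  have "f v \<in> V" if "v \<in> V" using assms that by (auto simp: Bij_def bij_betw_def)
  then show "perm_ext V (compose V g f) v = (perm_ext V g \<circ> perm_ext V f) v"
    by (simp add: perm_ext_def compose_def)
qed

lemma perm_ext_id: "perm_ext V (\<lambda>x\<in>V. x) = id"
  by (auto simp: perm_ext_def)

lemma perm_ext_eq_id:
  assumes "f \<in> Bij V" "perm_ext V f = id"
  shows "f = (\<lambda>x\<in>V. x)"
proof
  fix v
  show "f v = (\<lambda>x\<in>V. x) v"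
  proof (cases "v \<in> V")
    case True
    then show ?thesis using fun_cong[OF assms(2), of v] by (simp add: perm_ext_def)
  next
    case False
    then show ?thesis using assms(1) by (simp add: Bij_def extensional_def)
  qed
qed

lemma cubic_action_of_graph:
  fixes \<Gamma> :: "'a pair_pre_digraph" and G N :: "('a \<Rightarrow> 'a) set"
  assumes graph: "pair_graph \<Gamma>"
    and conn: "Digraph_Component.connected (with_proj \<Gamma>)"
    and cubic: "cubic \<Gamma>"
    and G: "subgroup G (graph_Aut \<Gamma>)"
    and trans: "transitive_action (graph_Aut \<Gamma> \<lparr>carrier := G\<rparr>) (pverts \<Gamma>) (\<lambda>g. g)"
    and N: "N \<lhd> graph_Aut \<Gamma> \<lparr>carrier := G\<rparr>"
    and comm: "comm_group (graph_Aut \<Gamma> \<lparr>carrier := N\<rparr>)"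
    and nonreg: "\<not> semiregular_action (graph_Aut \<Gamma> \<lparr>carrier := N\<rparr>) (pverts \<Gamma>) (\<lambda>g. g)"
  shows "cubic_action (pverts \<Gamma>) (\<lambda>u v. (u, v) \<in> parcs \<Gamma>)
    (perm_ext (pverts \<Gamma>) ` G) (perm_ext (pverts \<Gamma>) ` N)"
proof -
  interpret pair_graph \<Gamma> by (rule graph)
  let ?V = "pverts \<Gamma>"
  let ?x = "perm_ext ?V"
  have sym: "(u, v) \<in> parcs \<Gamma> \<Longrightarrow> (v, u) \<in> parcs \<Gamma>" for u v
    using sym_arcs by (auto simp: symmetric_def dest: symD)
  have irr: "(v, v) \<notin> parcs \<Gamma>" for v using pair_no_loops by force
  have inV: "u \<in> ?V" "v \<in> ?V" if "(u, v) \<in> parcs \<Gamma>" for u v using wellformed' that by auto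
  have GA: "G \<subseteq> graph_aut \<Gamma>" using subgroup.subset[OF G] by (simp add: graph_Aut_def)
  have NG: "N \<subseteq> G" using subgroup.subset[OF normal_imp_subgroup[OF N]] by simp
  have GB: "g \<in> Bij ?V" if "g \<in> G" for g using GA that by (auto simp: graph_aut_def)
  have NB: "n \<in> Bij ?V" if "n \<in> N" for n using GB NG that by blast
  have mult: "g \<otimes>\<^bsub>graph_Aut \<Gamma>\<lparr>carrier := H\<rparr>\<^esub> h = compose ?V g h" if "g \<in> G" "h \<in> G" for g h H
    using GB that by (simp add: graph_Aut_def BijGroup_def)
  have one: "\<one>\<^bsub>graph_Aut \<Gamma>\<lparr>carrier := H\<rparr>\<^esub> = (\<lambda>x\<in>?V. x)" for H
    by (simp add: graph_Aut_def BijGroup_def)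
  have ext_mult: "?x (g \<otimes>\<^bsub>graph_Aut \<Gamma>\<lparr>carrier := H\<rparr>\<^esub> h) = ?x g \<circ> ?x h"
    if "g \<in> G" "h \<in> G" for g h H
    using mult[OF that] perm_ext_compose[OF GB[OF that(2)]] by simp
  interpret N: normal N "graph_Aut \<Gamma> \<lparr>carrier := G\<rparr>" by (rule N)
  have oneN: "(\<lambda>x\<in>?V. x) \<in> N" using subgroup.one_closed[OF normal_imp_subgroup[OF N]] unfolding one .
  show ?thesis
  proof unfold_locales
    show "finite ?V" by (rule pair_finite_verts)
    show "u \<in> ?V" if "(u, v) \<in> parcs \<Gamma>" for u v using inV that by blast
    show "(v, u) \<in> parcs \<Gamma>" if "(u, v) \<in> parcs \<Gamma>" for u v using sym that by blast
    show "(v, v) \<notin> parcs \<Gamma>" for v by (rule irr)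
    show "card {w. (v, w) \<in> parcs \<Gamma>} = 3" if "v \<in> ?V" for v
    proof -
      have "out_degree (with_proj \<Gamma>) v = 3" using cubic that by (simp add: cubic_def)
      moreover have "out_arcs (with_proj \<Gamma>) v = Pair v ` {w. (v, w) \<in> parcs \<Gamma>}"
        by (auto simp: out_arcs_def)
      ultimately show ?thesis by (simp add: out_degree_def card_image inj_on_def)
    qed
    show "X = ?V" if X: "X \<subseteq> ?V" "X \<noteq> {}" "\<And>x y. x \<in> X \<Longrightarrow> (x, y) \<in> parcs \<Gamma> \<Longrightarrow> y \<in> X" for X
    proof
      show "?V \<subseteq> X"
      proof
        fix v assume v: "v \<in> ?V"
        obtain u where u: "u \<in> X" using X by blast
        have "u \<rightarrow>\<^sup>*\<^bsub>with_proj (mk_symmetric (with_proj \<Gamma>))\<^esub> v"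
          using conn u v X(1) unfolding Digraph_Component.connected_def strongly_connected_def by auto
        then have "(u, v) \<in> (parcs (mk_symmetric (with_proj \<Gamma>)))\<^sup>*"
          using reachable_rtranclI by fastforce
        then show "v \<in> X"
        proof (induction rule: rtrancl_induct)
          case base
          show ?case by (rule u)
        next
          case (step y z)
          then have "(y, z) \<in> parcs \<Gamma>" using sym by (auto simp: parcs_mk_symmetric)
          then show ?case using X(3) step by blast
        qed
      qed
    qed (rule X)
    show "g permutes ?V" if "g \<in> ?x ` G" for g using that GB perm_ext_permutes by blast
    show "(g u, g v) \<in> parcs \<Gamma> \<longleftrightarrow> (u, v) \<in> parcs \<Gamma>" if g: "g \<in> ?x ` G" for g u v
    proof -
      obtain f where f: "f \<in> G" "g = ?x f" using g by blast
      have window: "g permutes ?V" using GB[OF f(1)] perm_ext_permutes f(2) by blast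
      show ?thesis
      proof (cases "u \<in> ?V \<and> v \<in> ?V")
        case True
        then show ?thesis using GA f by (auto simp: perm_ext_apply graph_aut_def)
      next
        case False
        then show ?thesis using inV permutes_in_image[OF window] by metis
      qed
    qed
    show "\<exists>g\<in>?x ` G. g u = v" if "u \<in> ?V" "v \<in> ?V" for u v
      using transitive_action.unique_orbit[OF trans that] that by (auto simp: perm_ext_apply)
    show "?x ` N \<subseteq> ?x ` G" using NG by blast
    show "\<exists>m\<in>?x ` N. g \<circ> n = m \<circ> g" if gn: "g \<in> ?x ` G" "n \<in> ?x ` N" for g n
    proof -
      obtain g' n' where *: "g' \<in> G" "n' \<in> N" "g = ?x g'" "n = ?x n'" using gn by blast
      have "g' \<otimes>\<^bsub>graph_Aut \<Gamma>\<lparr>carrier := G\<rparr>\<^esub> n' \<in> g' <#\<^bsub>graph_Aut \<Gamma>\<lparr>carrier := G\<rparr>\<^esub> N"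
        using *(2) by (auto simp: l_coset_def)
      also have "\<dots> = N #>\<^bsub>graph_Aut \<Gamma>\<lparr>carrier := G\<rparr>\<^esub> g'" using N.coset_eq *(1) by simp
      finally obtain m where m: "m \<in> N" "g' \<otimes>\<^bsub>graph_Aut \<Gamma>\<lparr>carrier := G\<rparr>\<^esub> n' =
          m \<otimes>\<^bsub>graph_Aut \<Gamma>\<lparr>carrier := G\<rparr>\<^esub> g'" by (auto simp: r_coset_def)
      have G: "n' \<in> G" "m \<in> G" using NG *(2) m(1) by blast+
      have "?x g' \<circ> ?x n' = ?x m \<circ> ?x g'"
        using ext_mult[OF *(1) G(1), of G] ext_mult[OF G(2) *(1), of G] m(2) by (simp only:)
      then show ?thesis using m(1) *(3,4) by blast
    qed
    show "id \<in> ?x ` N"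
      using imageI[OF oneN, of ?x] unfolding perm_ext_id .
    show "m \<circ> n \<in> ?x ` N" if mn: "m \<in> ?x ` N" "n \<in> ?x ` N" for m n
    proof -
      obtain m' n' where *: "m' \<in> N" "n' \<in> N" "m = ?x m'" "n = ?x n'" using mn by blast
      then have "m' \<in> G" "n' \<in> G" using NG by blast+
      then have "m \<circ> n = ?x (m' \<otimes>\<^bsub>graph_Aut \<Gamma>\<lparr>carrier := G\<rparr>\<^esub> n')"
        using ext_mult[of m' n' G] *(3,4) by (simp only:)
      then show ?thesis using subgroup.m_closed[OF normal_imp_subgroup[OF N] *(1,2)] by blast
    qed
    show "m \<circ> n = n \<circ> m" if mn: "m \<in> ?x ` N" "n \<in> ?x ` N" for m n
    proof -
      interpret C: comm_group "graph_Aut \<Gamma> \<lparr>carrier := N\<rparr>" by (rule comm)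
      obtain m' n' where *: "m' \<in> N" "n' \<in> N" "m = ?x m'" "n = ?x n'" using mn by blast
      have "m' \<otimes>\<^bsub>graph_Aut \<Gamma>\<lparr>carrier := N\<rparr>\<^esub> n' = n' \<otimes>\<^bsub>graph_Aut \<Gamma>\<lparr>carrier := N\<rparr>\<^esub> m'"
        using C.m_comm * by simp
      moreover have "m' \<in> G" "n' \<in> G" using NG *(1,2) by blast+
      ultimately have "?x m' \<circ> ?x n' = ?x n' \<circ> ?x m'"
        using ext_mult[of m' n' N] ext_mult[of n' m' N] by (simp only:)
      then show ?thesis using *(3,4) by (simp only:)
    qed
    show "\<exists>v\<in>?V. \<exists>n\<in>?x ` N. n v = v \<and> n \<noteq> id"
    proof -
      obtain v where v: "v \<in> ?V"
        "stabilizer (graph_Aut \<Gamma> \<lparr>carrier := N\<rparr>) (\<lambda>g. g) v \<noteq> {\<one>\<^bsub>graph_Aut \<Gamma> \<lparr>carrier := N\<rparr>\<^esub>}"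
        using nonreg by (auto simp: semiregular_action_def)
      obtain n where n: "n \<in> N" "n v = v" "n \<noteq> (\<lambda>x\<in>?V. x)"
        using v oneN unfolding one stabilizer_def by auto
      have "?x n \<noteq> id" using perm_ext_eq_id[OF NB[OF n(1)]] n(3) by blast
      moreover have "?x n v = v" using n(2) v(1) by (simp add: perm_ext_apply)
      ultimately show ?thesis using n(1) v(1) by blast
    qed
  qed
qed

text \<open>
  The labels give \<open>1 \<le> s < r\<close>, so \<open>r = 2\<close> is the only value to be treated apart; then \<open>s = 1\<close>, and
  the graph is the cube.
\<close>

theorem theorem1p2:
  fixes \<Gamma> :: "'a pair_pre_digraph"
    and G N :: "('a \<Rightarrow> 'a) set"
  assumes "pair_graph \<Gamma>"
    and "Digraph_Component.connected (with_proj \<Gamma>)"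
    and "cubic \<Gamma>"
    and "subgroup G (graph_Aut \<Gamma>)"
    and "transitive_action (graph_Aut \<Gamma> \<lparr>carrier := G\<rparr>) (pverts \<Gamma>) (\<lambda>g. g)"
    and "N \<lhd> graph_Aut \<Gamma> \<lparr>carrier := G\<rparr>"
    and "comm_group (graph_Aut \<Gamma> \<lparr>carrier := N\<rparr>)"
    and "\<not> semiregular_action (graph_Aut \<Gamma> \<lparr>carrier := N\<rparr>) (pverts \<Gamma>) (\<lambda>g. g)"
  shows "K\<^bsub>4\<^esub> (with_proj \<Gamma>) \<or> K\<^bsub>3,3\<^esub> (with_proj \<Gamma>) \<or> graph_iso \<Gamma> (cube_graph 3) \<or>
    (\<exists>r s. 3 \<le> r \<and> 1 \<le> s \<and> s \<le> r - 1 \<and> graph_iso \<Gamma> (SPX r s))"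
proof -
  interpret pair_graph \<Gamma> by (rule assms(1))
  have wf: "pair_wf_digraph \<Gamma>" by unfold_locales
  have inV: "u \<in> pverts \<Gamma>" "v \<in> pverts \<Gamma>" if "(u, v) \<in> parcs \<Gamma>" for u v using wellformed' that by auto
  interpret cubic_action "pverts \<Gamma>" "\<lambda>u v. (u, v) \<in> parcs \<Gamma>"
    "perm_ext (pverts \<Gamma>) ` G" "perm_ext (pverts \<Gamma>) ` N"
    by (rule cubic_action_of_graph) (rule assms)+
  from cubic_action_classification show ?thesis
  proof (elim disjE exE conjE)
    fix A B assume *: "pverts \<Gamma> = A \<union> B" "A \<inter> B = {}" "card A = 3" "card B = 3"
      "\<forall>x y. (x, y) \<in> parcs \<Gamma> \<longleftrightarrow> x \<in> A \<and> y \<in> B \<or> x \<in> B \<and> y \<in> A"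
    then have "parcs \<Gamma> = A \<times> B \<union> B \<times> A" by auto
    then have "K\<^bsub>3,3\<^esub> (with_proj \<Gamma>)"
      unfolding complete_bipartite_digraph_pair_def using * pair_finite_verts by blast
    then show ?thesis by blast
  next
    assume *: "card (pverts \<Gamma>) = 4" "\<forall>x\<in>pverts \<Gamma>. \<forall>y\<in>pverts \<Gamma>. (x, y) \<in> parcs \<Gamma> \<longleftrightarrow> x \<noteq> y"
    have "(u, v) \<in> parcs \<Gamma> \<longleftrightarrow> u \<in> pverts \<Gamma> \<and> v \<in> pverts \<Gamma> \<and> u \<noteq> v" for u v
      using *(2) inV[of u v] by blast
    then have "parcs \<Gamma> = {(u, v). (u, v) \<in> pverts \<Gamma> \<times> pverts \<Gamma> \<and> u \<noteq> v}" by auto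
    then have "K\<^bsub>4\<^esub> (with_proj \<Gamma>)"
      unfolding complete_digraph_pair_def using * pair_finite_verts by blast
    then show ?thesis by blast
  next
    fix r s \<phi> assume *: "1 \<le> s" "s < r" "bij_betw \<phi> (pverts \<Gamma>) (SPX_verts r s)"
      "\<forall>u\<in>pverts \<Gamma>. \<forall>v\<in>pverts \<Gamma>. {\<phi> u, \<phi> v} \<in> SPX_edges r s \<longleftrightarrow> (u, v) \<in> parcs \<Gamma>"
    have im: "\<phi> u \<in> SPX_verts r s" if "u \<in> pverts \<Gamma>" for u using *(3) that by (auto simp: bij_betw_def)
    show ?thesis
    proof (cases "3 \<le> r")
      case True
      have "graph_iso \<Gamma> (SPX r s)"
      proof (rule graph_isoI[OF wf])
        show "parcs (SPX r s) \<subseteq> pverts (SPX r s) \<times> pverts (SPX r s)"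
          unfolding SPX_def graph_of_edges_simps(1) by (rule graph_of_edges_simps(3))
        show "bij_betw \<phi> (pverts \<Gamma>) (pverts (SPX r s))"
          unfolding SPX_def graph_of_edges_simps(1) by (rule *(3))
        show "(\<phi> u, \<phi> v) \<in> parcs (SPX r s) \<longleftrightarrow> (u, v) \<in> parcs \<Gamma>"
          if "u \<in> pverts \<Gamma>" "v \<in> pverts \<Gamma>" for u v
          unfolding SPX_def graph_of_edges_simps(2) using *(4) im that by blast
      qed
      then show ?thesis using True * by fastforce
    next
      case False
      then have rs: "r = 2" "s = 1" using * by auto
      have "graph_iso \<Gamma> (cube_graph 3)"
      proof (rule graph_isoI[OF wf])
        show "parcs (cube_graph 3) \<subseteq> pverts (cube_graph 3) \<times> pverts (cube_graph 3)"
          unfolding cube_graph_def graph_of_edges_simps(1) by (rule graph_of_edges_simps(3))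
        show "bij_betw (cube_code \<circ> \<phi>) (pverts \<Gamma>) (pverts (cube_graph 3))"
          unfolding cube_graph_def graph_of_edges_simps(1)
          by (rule bij_betw_trans[OF *(3)[unfolded rs] cube_code_bij])
        show "((cube_code \<circ> \<phi>) u, (cube_code \<circ> \<phi>) v) \<in> parcs (cube_graph 3) \<longleftrightarrow> (u, v) \<in> parcs \<Gamma>"
          if "u \<in> pverts \<Gamma>" "v \<in> pverts \<Gamma>" for u v
          using cube_code_edge[of "\<phi> u" "\<phi> v"] im[OF that(1)] im[OF that(2)] *(4) that unfolding rs by simp
      qed
      then show ?thesis by blast
    qed
  qed
qed

end
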